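(* Let $\mathcal H=\{H_i\}_{i=1}^n$ be a collection of (oriented) linear hyperplanes in $\mathbb R^k$ whose normals span $\mathbb R^k$. Suppose $L\subseteq\mathbb R^k$ is a linear subspace of dimension $l\ge2$ not contained in any $H_i$. Then either (i) $L\cap R_{\boldsymbol +}\neq\emptyset$, or (ii) there is some $\mathbf b\in\{-,+\}^n$, $\mathbf b\neq\boldsymbol+,\boldsymbol-$, such that $L\cap\Lambda_{\mathcal H}(\mathbf b)\neq\emptyset$ and $\widetilde H^{l-2-i}(L\cap\Lambda_{\mathcal H}(\mathbf b);\Bbbk)\neq0$ for some $i\ge0$, but not both.
   Context: $\Bbbk$ is a fixed field. The hyperplanes are given by row vectors $w_i$ with $H_i=\{x\in\mathbb R^k:w_ix=0\}$, and $W$ is the matrix with rows $w_i$ (of full rank $k$). For $\mathbf b\in\{-,+\}^n$, $R_{\mathbf b}=\{x\in\mathbb R^k:\operatorname{sgn}(Wx)=\mathbf b\}$. $\boldsymbol+$ and $\boldsymbol-$ are the constant sign vectors, so $R_{\boldsymbol+}=\{x:Wx>0\}$. $\Lambda_{\mathcal H}(\mathbf b)$ is the union of the (closed) facets of (the closure of) $R_{\mathbf b}\cap S^{k-1}$ whose linear spans separate $R_{\mathbf b}$ and $R_{\boldsymbol+}$; it is empty if $R_{\mathbf b}$ is empty. $S^{k-1}$ is the unit sphere of $\mathbb R^k$ and $\widetilde H$ is reduced cohomology. *)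

theory Defs
  imports "HOL-Analysis.Analysis" "HOL-Homology.Homology"
begin

section \<open>Reduced singular cohomology with coefficients in a field\<close>

text \<open>
  The library provides singular homology with integer coefficients only. We use its singular
  simplices and faces to build the augmented singular cochain complex
  \<open>0 \<rightarrow> K \<rightarrow> C\<^sup>0(X;K) \<rightarrow> C\<^sup>1(X;K) \<rightarrow> \<dots>\<close>, indexed by integers. Its term \<open>K\<close> in degree \<open>-1\<close> consists of the
  functions on the single \<open>(-1)\<close>-simplex, the empty map, which is represented by the only
  function that is extensional on \<open>{}\<close>. Hence the reduced cohomology of the empty space is \<open>K\<close>
  in degree \<open>-1\<close>.
\<close>

type_synonym 'a sing_simplex = "(nat \<Rightarrow> real) \<Rightarrow> 'a"

definition aug_simplices :: "int \<Rightarrow> 'a topology \<Rightarrow> 'a sing_simplex set" where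
  "aug_simplices d X =
     (if 0 \<le> d then singular_simplex_set (nat d) X
      else if d = -1 then {\<lambda>_. undefined} else {})"

definition aug_face :: "int \<Rightarrow> nat \<Rightarrow> 'a sing_simplex \<Rightarrow> 'a sing_simplex" where
  "aug_face d k s = (if 1 \<le> d then singular_face (nat d) k s else (\<lambda>_. undefined))"

text \<open>A cochain is a function on simplices, made total by the value 0 off the simplices of \<open>X\<close>.\<close>

definition cochain_group :: "int \<Rightarrow> 'a topology \<Rightarrow> ('a sing_simplex \<Rightarrow> 'f::field) monoid" where
  "cochain_group d X =
     \<lparr>carrier = {c. \<forall>s. s \<notin> aug_simplices d X \<longrightarrow> c s = 0},
      mult = (\<lambda>c c' s. c s + c' s),
      one = (\<lambda>s. 0)\<rparr>"

definition coboundary ::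
    "int \<Rightarrow> 'a topology \<Rightarrow> ('a sing_simplex \<Rightarrow> 'f::field) \<Rightarrow> 'a sing_simplex \<Rightarrow> 'f" where
  "coboundary d X c =
     (\<lambda>s. if s \<in> aug_simplices (d + 1) X
          then \<Sum>k\<le>nat (d + 1). (-1) ^ k * c (aug_face (d + 1) k s) else 0)"

definition cocycle_group :: "int \<Rightarrow> 'a topology \<Rightarrow> ('a sing_simplex \<Rightarrow> 'f::field) monoid" where
  "cocycle_group d X = subgroup_generated (cochain_group d X)
     (kernel (cochain_group d X) (cochain_group (d + 1) X) (coboundary d X))"

definition coboundary_set :: "int \<Rightarrow> 'a topology \<Rightarrow> ('a sing_simplex \<Rightarrow> 'f::field) set" where
  "coboundary_set d X = coboundary (d - 1) X ` carrier (cochain_group (d - 1) X)"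

definition reduced_cohomology_group ::
    "int \<Rightarrow> 'a topology \<Rightarrow> ('a sing_simplex \<Rightarrow> 'f::field) set monoid" where
  "reduced_cohomology_group d X = cocycle_group d X Mod coboundary_set d X"

lemma comm_group_cochain_group: "comm_group (cochain_group d X)"
proof (rule comm_groupI)
  fix x :: "'a sing_simplex \<Rightarrow> 'f::field"
  assume "x \<in> carrier (cochain_group d X)"
  then show "\<exists>y\<in>carrier (cochain_group d X). y \<otimes>\<^bsub>cochain_group d X\<^esub> x = \<one>\<^bsub>cochain_group d X\<^esub>"
    by (intro bexI[of _ "\<lambda>s. - x s"]) (auto simp: cochain_group_def)
qed (auto simp: cochain_group_def add.assoc add.commute)

lemma group_hom_coboundary:
  "group_hom (cochain_group d X) (cochain_group (d + 1) X) (coboundary d X)"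
proof -
  have "coboundary d X \<in> hom (cochain_group d X) (cochain_group (d + 1) X)"
    by (auto simp: hom_def cochain_group_def coboundary_def fun_eq_iff
        sum.distrib[symmetric] distrib_left)
  then show ?thesis
    using comm_group.axioms(2)[OF comm_group_cochain_group]
    by (auto simp: group_hom_def group_hom_axioms_def)
qed

lemma aug_face_in_aug_simplices:
  assumes "s \<in> aug_simplices d X" "int k \<le> d" "0 \<le> d"
  shows "aug_face d k s \<in> aug_simplices (d - 1) X"
proof (cases "1 \<le> d")
  case True
  then have "nat (d - 1) = nat d - Suc 0" by simp
  with True assms show ?thesis
    by (auto simp: aug_simplices_def aug_face_def intro!: singular_simplex_singular_face)
qed (use assms in \<open>auto simp: aug_simplices_def aug_face_def\<close>)

lemma singular_face_singular_face:
  assumes "2 \<le> p" "i \<le> j" "j \<le> p - Suc 0"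
  shows "singular_face (p - Suc 0) i (singular_face p (Suc j) g) =
         singular_face (p - Suc 0) j (singular_face p i g)"
proof (rule ext)
  fix t
  show "singular_face (p - Suc 0) i (singular_face p (Suc j) g) t =
        singular_face (p - Suc 0) j (singular_face p i g) t"
  proof (cases "t \<in> standard_simplex (p - 1 - 1)")
    case True
    have fi: "simplical_face i t \<in> standard_simplex (p - Suc 0)"
      using True simplical_face_in_standard_simplex[of "p - 1" i t] assms by auto
    have fj: "simplical_face j t \<in> standard_simplex (p - Suc 0)"
      using True simplical_face_in_standard_simplex[of "p - 1" j t] assms by auto
    have eq: "simplical_face (Suc j) (simplical_face i t) = simplical_face i (simplical_face j t)"
      using assms unfolding simplical_face_def by fastforce
    show ?thesis by (simp add: singular_face_def fi fj eq)
  qed (simp add: singular_face_def)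
qed

lemma aug_face_aug_face:
  assumes "1 \<le> d" "i \<le> j" "int j \<le> d - 1"
  shows "aug_face (d - 1) i (aug_face d (Suc j) s) = aug_face (d - 1) j (aug_face d i s)"
proof (cases "2 \<le> d")
  case True
  then have "nat (d - 1) = nat d - Suc 0" by simp
  with True assms show ?thesis
    using singular_face_singular_face[of "nat d" i j s] by (auto simp: aug_face_def)
qed (auto simp: aug_face_def)

lemma alternating_double_sum_zero:
  fixes a :: "nat \<Rightarrow> nat \<Rightarrow> 'f::field"
  assumes "\<And>i j. i \<le> j \<Longrightarrow> j \<le> p \<Longrightarrow> a (Suc j) i = a i j"
  shows "(\<Sum>k\<le>Suc p. \<Sum>i\<le>p. (-1) ^ (k + i) * a k i) = 0"
proof -
  let ?g = "\<lambda>(k, i). (-1) ^ (k + i) * a k i"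
  let ?A = "{(k, i). k \<le> i \<and> i \<le> p}" and ?B = "{(k, i). i < k \<and> k \<le> Suc p}"
  have fin: "finite ?A" "finite ?B"
    by (rule finite_subset[of _ "{..Suc p} \<times> {..Suc p}"]; auto)+
  have "{..Suc p} \<times> {..p} = ?A \<union> ?B" by auto
  then have "(\<Sum>k\<le>Suc p. \<Sum>i\<le>p. (-1) ^ (k + i) * a k i) = sum ?g (?A \<union> ?B)"
    by (simp only: sum.cartesian_product)
  also have "\<dots> = sum ?g ?A + sum ?g ?B"
    by (rule sum.union_disjoint[OF fin]) auto
  also have "sum ?g ?B = (\<Sum>x\<in>?A. - ?g x)"
    apply (rule sum.reindex_bij_witness
        [of _ "\<lambda>(i, j). (Suc j, i)" "\<lambda>(k, i). (i, k - 1)"])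
    apply (clarsimp)
    apply (clarsimp) subgoal by linarith
    apply (clarsimp)
    apply (clarsimp)
    subgoal for x
      apply (cases x; cases "fst x") apply (simp_all add: assms add.commute)
      done
    done
  finally show ?thesis by (simp add: sum_negf)
qed

lemma coboundary_coboundary:
  assumes "c \<in> carrier (cochain_group d X)"
  shows "coboundary (d + 1) X (coboundary d X c) = (\<lambda>s. 0)"
proof (rule ext)
  fix s
  show "coboundary (d + 1) X (coboundary d X c) s = 0"
  proof (cases "-1 \<le> d \<and> s \<in> aug_simplices (d + 2) X")
    case True
    then have "0 \<le> d + 1" by simp
    then obtain p where p: "d + 1 = int p" using nonneg_int_cases by blast
    have n: "nat (d + 2) = Suc p" "nat (d + 1) = p" using p by auto
    have f: "aug_face (d + 2) k s \<in> aug_simplices (d + 1) X" if "k \<le> Suc p" for k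
      using aug_face_in_aug_simplices[of s "d + 2" X k] True that p by (simp add: algebra_simps)
    have "coboundary (d + 1) X (coboundary d X c) s =
        (\<Sum>k\<le>Suc p. \<Sum>i\<le>p. (-1) ^ (k + i) * c (aug_face (d + 1) i (aug_face (d + 2) k s)))"
      using True f n by (simp add: coboundary_def sum_distrib_left power_add mult.assoc
          add.assoc del: sum.atMost_Suc)
    also have "\<dots> = 0"
      using aug_face_aug_face[of "d + 2" _ _ s] p
      by (intro alternating_double_sum_zero) (simp add: algebra_simps)
    finally show ?thesis .
  next
    case False
    then consider "s \<notin> aug_simplices (d + 2) X" | "d < -1" by linarith
    then show ?thesis
    proof cases
      case 1
      then show ?thesis by (simp add: coboundary_def add.assoc)
    next
      case 2
      then have "c = (\<lambda>s. 0)"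
        using assms by (auto simp: cochain_group_def aug_simplices_def)
      then have "coboundary d X c = (\<lambda>s. 0)" by (simp add: coboundary_def fun_eq_iff)
      then show ?thesis by (simp add: coboundary_def)
    qed
  qed
qed

lemma comm_group_reduced_cohomology_group:
  "comm_group (reduced_cohomology_group d X :: ('a sing_simplex \<Rightarrow> 'f::field) set monoid)"
proof -
  let ?C = "cochain_group d X :: ('a sing_simplex \<Rightarrow> 'f) monoid"
  let ?Z = "kernel ?C (cochain_group (d + 1) X) (coboundary d X)"
  let ?B = "coboundary_set d X :: ('a sing_simplex \<Rightarrow> 'f) set"
  interpret C: comm_group ?C by (rule comm_group_cochain_group)
  interpret D: group_hom ?C "cochain_group (d + 1) X :: ('a sing_simplex \<Rightarrow> 'f) monoid" "coboundary d X"
    by (rule group_hom_coboundary)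
  interpret E: group_hom "cochain_group (d - 1) X :: ('a sing_simplex \<Rightarrow> 'f) monoid" ?C "coboundary (d - 1) X"
    using group_hom_coboundary[of "d - 1" X] by simp
  have sub: "?B \<subseteq> ?Z"
    using coboundary_coboundary[of _ "d - 1" X] E.hom_closed
    by (auto simp: coboundary_set_def kernel_def cochain_group_def)
  have "subgroup ?B (subgroup_generated ?C ?Z)"
    using E.img_is_subgroup D.subgroup_kernel sub
    by (simp add: C.subgroup_subgroup_generated_iff coboundary_set_def
        subgroup.carrier_subgroup_generated_subgroup)
  then show ?thesis
    unfolding reduced_cohomology_group_def cocycle_group_def
    by (intro comm_group.abelian_FactGroup C.abelian_subgroup_generated C.comm_group_axioms)
qed


section \<open>Oriented hyperplane arrangements\<close>

definition hyperplane :: "real^'k^'n \<Rightarrow> 'n \<Rightarrow> (real^'k) set" where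
  "hyperplane W i = {x. row i W \<bullet> x = 0}"

text \<open>
  Sign vectors are functions with values in \<open>{-1, 1}\<close>. The sign of \<open>W *v x\<close> is taken in each
  component: \<open>sgn\<close> on the type \<open>real^'n\<close> would normalize the vector instead.
\<close>

definition region :: "real^'k^'n \<Rightarrow> ('n \<Rightarrow> real) \<Rightarrow> (real^'k) set" where
  "region W b = {x. \<forall>i. sgn ((W *v x) $ i) = b i}"

text \<open>
  The hyperplane \<open>H\<^sub>i\<close> is oriented by its normal, and the all-plus region lies on its positive side,
  so it separates \<open>R\<^sub>b\<close> from that region when \<open>R\<^sub>b\<close> lies on its negative side. Keeping track of the
  orientation only matters if the all-plus region is empty: then a hyperplane with \<open>R\<^sub>b\<close> on its
  positive side is not counted as separating.
\<close>

definition separates :: "real^'k^'n \<Rightarrow> 'n \<Rightarrow> ('n \<Rightarrow> real) \<Rightarrow> bool" where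
  "separates W i b \<longleftrightarrow>
     region W b \<subseteq> {x. row i W \<bullet> x < 0} \<and> region W (\<lambda>_. 1) \<subseteq> {x. row i W \<bullet> x > 0}"

text \<open>
  The facets of the spherical polytope \<open>closure R\<^sub>b \<inter> S\<^sup>k\<^sup>-\<^sup>1\<close> are the intersections with the sphere of
  the facets of the polyhedral cone \<open>closure R\<^sub>b\<close>. The empty set has no facets.
\<close>

definition Lambda :: "real^'k^'n \<Rightarrow> ('n \<Rightarrow> real) \<Rightarrow> (real^'k) set" where
  "Lambda W b =
     \<Union>{G. \<exists>F. F facet_of closure (region W b) \<and> G = F \<inter> sphere 0 1 \<and>
              (\<exists>i. span G = hyperplane W i \<and> separates W i b)}"

end

theory Submission
  imports Defs
begin

text \<open>
  Write \<open>C\<close> for the closure of a region \<open>R\<^sub>b\<close>, a pointed polyhedral cone because the normals span.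

  \<^item> If \<open>p\<close> lies in \<open>L \<inter> R\<^sub>+\<close>, then moving from \<open>x \<in> C\<close> in direction \<open>p\<close> increases the slack of the
    plus constraints and uses up that of the minus constraints. A point of the unit sphere in \<open>L \<inter> C\<close>
    belongs to \<open>\<Lambda>(b)\<close> exactly if this motion leaves \<open>C\<close> at once. Unless \<open>b\<close> is constant, every
    nonzero point of \<open>L \<inter> C\<close> can be pushed along \<open>p\<close> until it is about to leave, without ever reaching the
    origin; after normalization this is a retraction of the convex set \<open>(L \<inter> C) - {0}\<close> onto
    \<open>L \<inter> \<Lambda>(b)\<close>. So \<open>L \<inter> \<Lambda>(b)\<close> is contractible and has no reduced cohomology
    (\<open>active_in_Lambda\<close>, \<open>contractible_outgoing_boundary\<close>).

  \<^item> If \<open>L\<close> misses \<open>R\<^sub>+\<close>, then some region \<open>R\<^sub>b\<close> meeting \<open>L\<close> has the property that \<open>\<Lambda>(b)\<close> contains the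
    whole relative boundary of \<open>L \<inter> C\<close> on the sphere, which is a sphere of dimension \<open>l - 2\<close>; hence the
    reduced cohomology in degree \<open>l - 2\<close> is not zero. Such a region is found by an extremal argument.
    Every wall \<open>M\<close> of the arrangement that is induced on \<open>L\<close> has two sides. Looking only at the
    hyperplanes that cut \<open>L\<close> in \<open>M\<close>, and at the cone in \<open>\<real>\<^sup>k\<close> that they bound, call \<open>M\<close> visible from
    a side if some facet of that cone is one that \<open>\<Lambda>\<close> collects, that is, carries a minus sign.
    Passing to the other side negates the cone and all signs, so \<open>M\<close> is visible from at least one side.
    A region of \<open>L\<close> that lies on the hidden side of as few walls as possible sees all its own
    walls, since crossing a hidden one would lower the count
    (\<open>visible_trace_opposite\<close>, \<open>exists_region_with_visible_boundary\<close>, \<open>boundary_homeomorphic_nsphere\<close>).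

  The cohomology groups with field coefficients are obtained from integral singular homology. If
  the augmented chain complex is exact in low degrees, one can choose a chain contraction there,
  simplex by simplex. It shows that an acyclic space has no reduced cohomology. It also splits off
  the cycles in the next degree, so that a homomorphism on homology extends to a cocycle on all
  chains; applied to a sphere this gives a nonzero class.
\<close>

section \<open>Cochains and the augmented integral chain complex\<close>

definition pairing :: "('b \<Rightarrow> 'f::field) \<Rightarrow> ('b \<Rightarrow>\<^sub>0 int) \<Rightarrow> 'f" where
  "pairing c x = (\<Sum>s\<in>Poly_Mapping.keys x. of_int (Poly_Mapping.lookup x s) * c s)"

lemma pairing_superset:
  assumes "finite S" "Poly_Mapping.keys x \<subseteq> S"
  shows "pairing c x = (\<Sum>s\<in>S. of_int (Poly_Mapping.lookup x s) * c s)"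
  unfolding pairing_def
proof (rule sum.mono_neutral_left[OF assms])
  show "\<forall>i\<in>S - Poly_Mapping.keys x. of_int (Poly_Mapping.lookup x i) * c i = 0"
    by (simp add: in_keys_iff)
qed

lemma pairing_0 [simp]: "pairing c 0 = 0"
  by (simp add: pairing_def)

lemma pairing_of [simp]: "pairing c (frag_of s) = c s"
  by (simp add: pairing_def keys_frag_of)

lemma pairing_diff: "pairing c (x - y) = pairing c x - pairing c y"
proof -
  let ?S = "Poly_Mapping.keys x \<union> Poly_Mapping.keys y"
  have "Poly_Mapping.keys (x - y) \<subseteq> ?S" by (rule keys_diff)
  then show ?thesis
    by (simp add: pairing_superset[of ?S] lookup_minus sum_subtractf left_diff_distrib)
qed

lemma pairing_cmul: "pairing c (frag_cmul k x) = of_int k * pairing c x"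
proof -
  have "Poly_Mapping.keys (frag_cmul k x) \<subseteq> Poly_Mapping.keys x" by (rule keys_cmul)
  then show ?thesis
    by (simp add: pairing_superset[of "Poly_Mapping.keys x"] sum_distrib_left mult.assoc)
qed

lemma pairing_add: "pairing c (x + y) = pairing c x + pairing c y"
  using pairing_diff[of c "x + y" y] by simp

lemma pairing_sum: "pairing c (\<Sum>i\<in>I. f i) = (\<Sum>i\<in>I. pairing c (f i))"
  by (induction I rule: infinite_finite_induct) (auto simp: pairing_add)

lemma pairing_cong:
  "(\<And>s. s \<in> Poly_Mapping.keys x \<Longrightarrow> c s = c' s) \<Longrightarrow> pairing c x = pairing c' x"
  by (simp add: pairing_def)

lemma pairing_extend:
  "pairing c (frag_extend f x) = pairing (\<lambda>s. pairing c (f s)) x"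
  by (simp add: frag_extend_def pairing_sum pairing_cmul) (simp add: pairing_def)

text \<open>
  The augmented integral chain complex, with the augmentation as the boundary in degree 0: this is
  the complex whose dual is the cochain complex of the reduced cohomology.
\<close>

definition aug_chain :: "int \<Rightarrow> 'a topology \<Rightarrow> ('a sing_simplex \<Rightarrow>\<^sub>0 int) \<Rightarrow> bool" where
  "aug_chain d X x \<longleftrightarrow> Poly_Mapping.keys x \<subseteq> aug_simplices d X"

definition aug_boundary :: "int \<Rightarrow> ('a sing_simplex \<Rightarrow>\<^sub>0 int) \<Rightarrow> ('a sing_simplex \<Rightarrow>\<^sub>0 int)" where
  "aug_boundary d =
     frag_extend (\<lambda>s. if 0 \<le> d then \<Sum>k\<le>nat d. frag_cmul ((-1) ^ k) (frag_of (aug_face d k s)) else 0)"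

text \<open>
  Vanishing of the homology of the augmented complex in degree \<open>d\<close>, stated with chains so that a
  bounding chain can be chosen for each simplex separately.
\<close>

definition aug_exact :: "int \<Rightarrow> 'a topology \<Rightarrow> bool" where
  "aug_exact d X \<longleftrightarrow> (\<forall>z. aug_chain d X z \<and> aug_boundary d z = 0 \<longrightarrow>
     (\<exists>y. aug_chain (d + 1) X y \<and> aug_boundary (d + 1) y = z))"

lemma aug_boundary_diff: "aug_boundary d (x - y) = aug_boundary d x - aug_boundary d y"
  by (simp add: aug_boundary_def frag_extend_diff)

lemma aug_chain_diff: "aug_chain d X x \<Longrightarrow> aug_chain d X y \<Longrightarrow> aug_chain d X (x - y)"
  unfolding aug_chain_def using keys_diff[of x y] by blast

lemma aug_chain_of [simp]: "aug_chain d X (frag_of s) \<longleftrightarrow> s \<in> aug_simplices d X"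
  by (simp add: aug_chain_def keys_frag_of)

lemma aug_chain_0 [simp]: "aug_chain d X 0"
  by (simp add: aug_chain_def)

lemma aug_chain_induct [consumes 1, case_names zero one diff]:
  assumes "aug_chain d X x" "P 0" "\<And>s. s \<in> aug_simplices d X \<Longrightarrow> P (frag_of s)"
    "\<And>x y. P x \<Longrightarrow> P y \<Longrightarrow> P (x - y)"
  shows "P x"
  using assms unfolding aug_chain_def by (rule frag_induction)

lemma aug_chain_extend:
  assumes "aug_chain d X x" "\<And>s. s \<in> aug_simplices d X \<Longrightarrow> aug_chain d' Y (f s)"
  shows "aug_chain d' Y (frag_extend f x)"
  using assms keys_frag_extend[of f x] unfolding aug_chain_def by blast

lemma aug_chain_boundary:
  assumes "aug_chain d X x"
  shows "aug_chain (d - 1) X (aug_boundary d x)"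
  unfolding aug_boundary_def
proof (rule aug_chain_extend[OF assms], cases "0 \<le> d")
  case True
  fix s assume s: "s \<in> aug_simplices d X"
  have "aug_chain (d - 1) X (frag_cmul ((-1) ^ k) (frag_of (aug_face d k s)))" if "k \<le> nat d" for k
    using aug_face_in_aug_simplices[OF s, of k] that True keys_cmul[of "(-1) ^ k" "frag_of (aug_face d k s)"]
    by (auto simp: aug_chain_def)
  then have "aug_chain (d - 1) X (\<Sum>k\<le>nat d. frag_cmul ((-1) ^ k) (frag_of (aug_face d k s)))"
    unfolding aug_chain_def by (intro order_trans[OF keys_sum]) auto
  then show "aug_chain (d - 1) X
     (if 0 \<le> d then \<Sum>k\<le>nat d. frag_cmul ((-1) ^ k) (frag_of (aug_face d k s)) else 0)"
    using True by simp
qed auto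

text \<open>
  The coboundary is the transpose of the boundary. Below degree \<open>-1\<close> this needs a cochain of the group:
  there the formula for the coboundary has a spurious term at the constant function \<open>undefined\<close>, where
  such a cochain vanishes.
\<close>

lemma pairing_coboundary:
  assumes c: "c \<in> carrier (cochain_group d X)" and x: "aug_chain (d + 1) X x"
  shows "pairing (coboundary d X c) x = pairing c (aug_boundary (d + 1) x)"
  unfolding aug_boundary_def pairing_extend
proof (rule pairing_cong)
  fix s assume "s \<in> Poly_Mapping.keys x"
  then have s: "s \<in> aug_simplices (d + 1) X" using x by (auto simp: aug_chain_def)
  show "coboundary d X c s = pairing c (if 0 \<le> d + 1
      then \<Sum>k\<le>nat (d + 1). frag_cmul ((- 1) ^ k) (frag_of (aug_face (d + 1) k s)) else 0)"
  proof (cases "0 \<le> d + 1")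
    case True
    with s show ?thesis
      by (simp add: coboundary_def pairing_sum pairing_cmul)
  next
    case False
    then have "c = (\<lambda>s. 0)"
      using c by (auto simp: cochain_group_def aug_simplices_def)
    with False show ?thesis by (simp add: coboundary_def)
  qed
qed

text \<open>
  This is dual to the vanishing of the double coboundary: an integral chain is zero if all rational
  cochains vanish on it, and indicator cochains of single simplices suffice.
\<close>

lemma aug_boundary_boundary:
  assumes x: "aug_chain (d + 1) X x"
  shows "aug_boundary d (aug_boundary (d + 1) x) = 0"
proof -
  let ?z = "aug_boundary d (aug_boundary (d + 1) x)"
  have b: "aug_chain d X (aug_boundary (d + 1) x)"
    using aug_chain_boundary[OF x] by simp
  have z: "aug_chain (d - 1) X ?z"
    using aug_chain_boundary[OF b] by simp
  have "Poly_Mapping.lookup ?z s = 0" for s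
  proof (cases "s \<in> aug_simplices (d - 1) X")
    case True
    define c where "c t = (if t = s then 1 else 0 :: rat)" for t
    have c: "c \<in> carrier (cochain_group (d - 1) X)"
      using True by (auto simp: c_def cochain_group_def)
    have dc: "coboundary (d - 1) X c \<in> carrier (cochain_group d X)"
      by (simp add: cochain_group_def coboundary_def)
    have "pairing c ?z = pairing (coboundary (d - 1) X c) (aug_boundary (d + 1) x)"
      using pairing_coboundary[OF c, of "aug_boundary (d + 1) x"] b by simp
    also have "\<dots> = pairing (coboundary d X (coboundary (d - 1) X c)) x"
      using pairing_coboundary[OF dc x] by simp
    also have "\<dots> = 0"
      using coboundary_coboundary[OF c] by (simp add: pairing_def)
    finally have "pairing c ?z = 0" .
    moreover have "pairing c ?z = of_int (Poly_Mapping.lookup ?z s)"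
      by (simp add: pairing_superset[of "insert s (Poly_Mapping.keys ?z)"] c_def
          if_distrib[of "\<lambda>a. _ * a"] sum.delta subset_insertI cong: if_cong)
    ultimately show ?thesis by simp
  next
    case False
    then show ?thesis using z by (auto simp: aug_chain_def in_keys_iff)
  qed
  then show ?thesis by (intro poly_mapping_eqI) simp
qed


section \<open>Reduced cohomology from exactness of the integral complex\<close>

text \<open>
  A chain contraction chosen degree by degree: \<open>contraction X p\<close> maps degree \<open>p - 2\<close> to degree
  \<open>p - 1\<close>. The shift lets the recursion start with the zero map on the zero group in degree \<open>-2\<close>.
  On a simplex \<open>s\<close> the next map picks a chain bounded by the cycle \<open>s - h (\<partial> s)\<close>, where \<open>h\<close> is the
  previous map. Exactness provides such a chain, and the choices on simplices extend to all chains
  because the simplices form a basis.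
\<close>

primrec contraction :: "'a topology \<Rightarrow> nat \<Rightarrow> ('a sing_simplex \<Rightarrow>\<^sub>0 int) \<Rightarrow> ('a sing_simplex \<Rightarrow>\<^sub>0 int)"
  where
  "contraction X 0 = (\<lambda>x. 0)"
| "contraction X (Suc p) = frag_extend (\<lambda>s. SOME y. aug_chain (int p) X y \<and>
     aug_boundary (int p) y = frag_of s - contraction X p (aug_boundary (int p - 1) (frag_of s)))"

lemma contraction_diff: "contraction X p (x - y) = contraction X p x - contraction X p y"
  by (cases p) (auto simp: frag_extend_diff)

text \<open>
  The homotopy identity \<open>\<partial> h + h \<partial> = id\<close>. By induction \<open>s - h (\<partial> s)\<close> is a cycle, since
  \<open>\<partial> (h (\<partial> s)) = \<partial> s - h (\<partial> (\<partial> s)) = \<partial> s\<close>, so the choice in the definition is possible.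
\<close>

lemma contraction:
  assumes "\<And>q. q < p \<Longrightarrow> aug_exact (int q - 1) X"
    and "aug_chain (int p - 2) X x"
  shows "aug_chain (int p - 1) X (contraction X p x) \<and>
    (0 < p \<longrightarrow> aug_boundary (int p - 1) (contraction X p x) =
       x - contraction X (p - 1) (aug_boundary (int p - 2) x))"
  using assms
proof (induction p arbitrary: x)
  case 0
  then show ?case by simp
next
  case (Suc p)
  have IH: "aug_chain (int p - 1) X (contraction X p w)"
    "0 < p \<Longrightarrow> aug_boundary (int p - 1) (contraction X p w) =
       w - contraction X (p - 1) (aug_boundary (int p - 2) w)"
    if "aug_chain (int p - 2) X w" for w
    using Suc.IH[of w] Suc.prems(1) that by auto
  have s: "aug_chain (int p) X (contraction X (Suc p) (frag_of s)) \<and>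
     aug_boundary (int p) (contraction X (Suc p) (frag_of s)) =
       frag_of s - contraction X p (aug_boundary (int p - 1) (frag_of s))" (is "?Q s")
    if "s \<in> aug_simplices (int p - 1) X" for s
  proof -
    let ?b = "aug_boundary (int p - 1) (frag_of s)"
    let ?z = "frag_of s - contraction X p ?b"
    have fs: "aug_chain (int p - 1) X (frag_of s)" using that by simp
    have b: "aug_chain (int p - 2) X ?b"
      using aug_chain_boundary[OF fs] by simp
    have z: "aug_chain (int p - 1) X ?z"
      using fs IH(1)[OF b] by (rule aug_chain_diff)
    have "aug_boundary (int p - 1) ?z = 0"
    proof (cases "p = 0")
      case True
      then show ?thesis by (simp add: aug_boundary_def)
    next
      case False
      have bb: "aug_boundary (int p - 2) ?b = 0"
        using aug_boundary_boundary[of "int p - 2" X "frag_of s"] fs by simp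
      moreover have "contraction X (p - 1) 0 = 0"
        using contraction_diff[of X "p - 1" 0 0] by simp
      ultimately have "aug_boundary (int p - 1) (contraction X p ?b) = ?b"
        using IH(2)[OF b] False by simp
      then show ?thesis by (simp add: aug_boundary_diff)
    qed
    then obtain y where "aug_chain (int p) X y \<and> aug_boundary (int p) y = ?z"
      using Suc.prems(1)[of p] z by (auto simp: aug_exact_def)
    then show ?thesis by simp (rule someI)
  qed
  have "aug_chain (int p - 1) X x" using Suc.prems(2) by simp
  then have "aug_chain (int p) X (contraction X (Suc p) x) \<and>
     aug_boundary (int p) (contraction X (Suc p) x) =
       x - contraction X p (aug_boundary (int p - 1) x)"
  proof (induction x rule: aug_chain_induct)
    case zero
    then show ?case
      using contraction_diff[of X p 0 0] by (simp add: aug_boundary_def)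
  next
    case (one s)
    then show ?case by (rule s)
  next
    case (diff x y)
    then show ?case
      by (simp add: contraction_diff aug_boundary_diff aug_chain_diff del: contraction.simps)
  qed
  then show ?case by (simp del: contraction.simps)
qed

lemma carrier_cocycle_group:
  "carrier (cocycle_group d X :: ('a sing_simplex \<Rightarrow> 'f::field) monoid) =
     {c \<in> carrier (cochain_group d X). coboundary d X c = (\<lambda>s. 0)}"
proof -
  interpret D: group_hom "cochain_group d X :: ('a sing_simplex \<Rightarrow> 'f) monoid"
      "cochain_group (d + 1) X" "coboundary d X"
    by (rule group_hom_coboundary)
  show ?thesis
    unfolding cocycle_group_def subgroup.carrier_subgroup_generated_subgroup[OF D.subgroup_kernel]
    by (auto simp: kernel_def cochain_group_def)
qed

lemma trivial_reduced_cohomology_group_iff: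
  "trivial_group (reduced_cohomology_group d X :: ('a sing_simplex \<Rightarrow> 'f::field) set monoid) \<longleftrightarrow>
     (\<forall>c::'a sing_simplex \<Rightarrow> 'f. c \<in> carrier (cochain_group d X) \<and> coboundary d X c = (\<lambda>s. 0) \<longrightarrow>
        c \<in> coboundary_set d X)"
proof -
  let ?Z = "cocycle_group d X :: ('a sing_simplex \<Rightarrow> 'f) monoid"
  let ?B = "coboundary_set d X :: ('a sing_simplex \<Rightarrow> 'f) set"
  have mult: "mult ?Z = (\<lambda>c c' s. c s + c' s)"
    by (simp add: cocycle_group_def cochain_group_def)
  interpret E: group_hom "cochain_group (d - 1) X :: ('a sing_simplex \<Rightarrow> 'f) monoid"
      "cochain_group d X :: ('a sing_simplex \<Rightarrow> 'f) monoid" "coboundary (d - 1) X"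
    using group_hom_coboundary[of "d - 1" X] by simp
  have B: "subgroup ?B (cochain_group d X)"
    unfolding coboundary_set_def by (rule E.img_is_subgroup)
  have z: "(\<lambda>s. 0) \<in> ?B"
    using subgroup.one_closed[OF B] by (simp add: cochain_group_def)
  have add: "(\<lambda>s. a s + b s) \<in> ?B" if "a \<in> ?B" "b \<in> ?B" for a b
    using subgroup.m_closed[OF B that] by (simp add: cochain_group_def)
  have BZ: "?B \<subseteq> carrier ?Z"
    using coboundary_coboundary[of _ "d - 1" X] E.hom_closed
    by (auto simp: coboundary_set_def carrier_cocycle_group)
  have coset: "?B #>\<^bsub>?Z\<^esub> c = ?B \<longleftrightarrow> c \<in> ?B" if "c \<in> carrier ?Z" for c
  proof
    assume "?B #>\<^bsub>?Z\<^esub> c = ?B"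
    moreover have "c \<in> ?B #>\<^bsub>?Z\<^esub> c"
      using z by (auto simp: r_coset_def mult intro!: bexI[of _ "\<lambda>s. 0"])
    ultimately show "c \<in> ?B" by simp
  next
    assume c: "c \<in> ?B"
    have m: "(\<lambda>s. - c s) \<in> ?B"
    proof -
      have "(\<lambda>s. - c s) = inv\<^bsub>cochain_group d X\<^esub> c"
      proof (rule E.H.inv_equality[symmetric])
        show "c \<in> carrier (cochain_group d X)" using c B subgroup.subset by blast
        then show "(\<lambda>s. - c s) \<in> carrier (cochain_group d X)" by (simp add: cochain_group_def)
      qed (simp add: cochain_group_def)
      then show ?thesis using subgroup.m_inv_closed[OF B c] by simp
    qed
    show "?B #>\<^bsub>?Z\<^esub> c = ?B"
    proof
      show "?B #>\<^bsub>?Z\<^esub> c \<subseteq> ?B" using add[OF _ c] by (auto simp: r_coset_def mult)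
      show "?B \<subseteq> ?B #>\<^bsub>?Z\<^esub> c"
      proof
        fix b assume "b \<in> ?B"
        from add[OF this m] show "b \<in> ?B #>\<^bsub>?Z\<^esub> c"
          by (auto simp: r_coset_def mult intro!: bexI[of _ "\<lambda>s. b s + - c s"])
      qed
    qed
  qed
  have "trivial_group (?Z Mod ?B) \<longleftrightarrow> (\<forall>c\<in>carrier ?Z. ?B #>\<^bsub>?Z\<^esub> c = ?B)"
  proof -
    have "group (?Z Mod ?B)"
      using comm_group_reduced_cohomology_group[of d X, where 'f = 'f]
      by (simp add: reduced_cohomology_group_def comm_group.axioms)
    moreover have "carrier ?Z \<noteq> {}" using z BZ by auto
    ultimately show ?thesis
      by (auto simp: trivial_group_def FactGroup_def RCOSETS_def)
  qed
  then show ?thesis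
    using coset by (auto simp: reduced_cohomology_group_def carrier_cocycle_group)
qed

text \<open>
  With the contraction \<open>h\<close>, a cocycle \<open>c\<close> satisfies \<open>c = c \<circ> (\<partial> h + h \<partial>) = (c \<circ> h) \<circ> \<partial>\<close>, so it is the
  coboundary of \<open>c \<circ> h\<close>.
\<close>

theorem trivial_reduced_cohomology_group_if_exact:
  assumes exact: "\<And>q. q \<le> p \<Longrightarrow> aug_exact (int q - 1) X"
  shows "trivial_group
    (reduced_cohomology_group (int p - 1) X :: ('a sing_simplex \<Rightarrow> 'f::field) set monoid)"
  unfolding trivial_reduced_cohomology_group_iff
proof (intro allI impI, elim conjE)
  fix c :: "'a sing_simplex \<Rightarrow> 'f"
  assume c: "c \<in> carrier (cochain_group (int p - 1) X)" and cocycle: "coboundary (int p - 1) X c = (\<lambda>s. 0)"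
  define e where
    "e t = (if t \<in> aug_simplices (int p - 2) X then pairing c (contraction X p (frag_of t)) else 0)" for t
  have e: "pairing e x = pairing c (contraction X p x)" if "aug_chain (int p - 2) X x" for x
    using that
  proof (induction x rule: aug_chain_induct)
    case zero
    then show ?case using contraction_diff[of X p 0 0] by simp
  qed (auto simp: e_def pairing_diff contraction_diff)
  have ec: "e \<in> carrier (cochain_group (int p - 2) X)"
    by (auto simp: cochain_group_def e_def)
  have "c s = coboundary (int p - 2) X e s" for s
  proof (cases "s \<in> aug_simplices (int p - 1) X")
    case True
    let ?b = "aug_boundary (int p - 1) (frag_of s)"
    let ?y = "contraction X (Suc p) (frag_of s)"
    have s: "aug_chain (int p - 1) X (frag_of s)" using True by simp
    then have b: "aug_chain (int p - 2) X ?b" using aug_chain_boundary[OF s] by simp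
    have y: "aug_chain (int p) X ?y" "aug_boundary (int p) ?y = frag_of s - contraction X p ?b"
      using contraction[of "Suc p" X "frag_of s"] exact s
      by (auto simp: less_Suc_eq_le simp del: contraction.simps)
    have "0 = pairing (coboundary (int p - 1) X c) ?y"
      unfolding cocycle by (simp add: pairing_def)
    also have "\<dots> = pairing c (aug_boundary (int p) ?y)"
      using pairing_coboundary[OF c, of ?y] y(1) by simp
    finally have "c s = pairing c (contraction X p ?b)"
      unfolding y(2) by (simp add: pairing_diff)
    also have "\<dots> = pairing (coboundary (int p - 2) X e) (frag_of s)"
      using pairing_coboundary[OF ec, of "frag_of s"] s e[OF b] by simp
    finally show ?thesis by simp
  next
    case False
    then show ?thesis using c by (auto simp: cochain_group_def coboundary_def)
  qed
  then have "c = coboundary (int p - 2) X e" by auto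
  with ec show "c \<in> coboundary_set (int p - 1) X"
    by (simp add: coboundary_set_def)
qed

text \<open>
  The integral part of the universal coefficient theorem that is needed for spheres. Exactness below
  the degree in question makes \<open>x \<mapsto> x - h (\<partial> x)\<close> a projection of the chains onto the cycles. A
  homomorphism from the homology to the integers, composed with this projection, is a cocycle over
  any field; it is not a coboundary, as it takes the value 1 on a cycle.
\<close>

theorem nontrivial_reduced_cohomology_group_if_exact:
  fixes h :: "('a sing_simplex \<Rightarrow>\<^sub>0 int) \<Rightarrow> int"
  assumes exact: "\<And>q. q < p \<Longrightarrow> aug_exact (int q - 1) X"
    and diff: "\<And>x y. aug_chain (int p - 1) X x \<Longrightarrow> aug_boundary (int p - 1) x = 0 \<Longrightarrow>
        aug_chain (int p - 1) X y \<Longrightarrow> aug_boundary (int p - 1) y = 0 \<Longrightarrow> h (x - y) = h x - h y"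
    and bd: "\<And>y. aug_chain (int p) X y \<Longrightarrow> h (aug_boundary (int p) y) = 0"
    and z: "aug_chain (int p - 1) X z" "aug_boundary (int p - 1) z = 0" "h z = 1"
  shows "\<not> trivial_group
    (reduced_cohomology_group (int p - 1) X :: ('a sing_simplex \<Rightarrow> 'f::field) set monoid)"
proof
  define pr where "pr x = x - contraction X p (aug_boundary (int p - 1) x)"
    for x :: "'a sing_simplex \<Rightarrow>\<^sub>0 int"
  have c0: "contraction X q 0 = 0" for q
    using contraction_diff[of X q 0 0] by simp
  have pr: "aug_chain (int p - 1) X (pr x) \<and> aug_boundary (int p - 1) (pr x) = 0"
    if x: "aug_chain (int p - 1) X x" for x
  proof -
    let ?b = "aug_boundary (int p - 1) x"
    have b: "aug_chain (int p - 2) X ?b" using aug_chain_boundary[OF x] by simp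
    have "aug_boundary (int p - 2) ?b = 0"
      using aug_boundary_boundary[of "int p - 2" X x] x by simp
    with contraction[OF exact b] have
      "aug_chain (int p - 1) X (contraction X p ?b)"
      "0 < p \<Longrightarrow> aug_boundary (int p - 1) (contraction X p ?b) = ?b"
      by (auto simp: c0)
    moreover have "aug_boundary (int p - 1) w = 0" if "p = 0" for w :: "'a sing_simplex \<Rightarrow>\<^sub>0 int"
      using that by (simp add: aug_boundary_def frag_extend_eq_0)
    ultimately have "aug_boundary (int p - 1) (pr x) = 0"
      by (cases "p = 0") (auto simp: pr_def aug_boundary_diff)
    moreover have "aug_chain (int p - 1) X (pr x)"
      unfolding pr_def using x \<open>aug_chain (int p - 1) X (contraction X p ?b)\<close> by (rule aug_chain_diff)
    ultimately show ?thesis by blast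
  qed
  have pr_diff: "pr (x - y) = pr x - pr y" for x y
    by (simp add: pr_def aug_boundary_diff contraction_diff)
  define c :: "'a sing_simplex \<Rightarrow> 'f" where
    "c s = (if s \<in> aug_simplices (int p - 1) X then of_int (h (pr (frag_of s))) else 0)" for s
  have cc: "c \<in> carrier (cochain_group (int p - 1) X)"
    by (auto simp: cochain_group_def c_def)
  have c: "pairing c x = of_int (h (pr x))" if "aug_chain (int p - 1) X x" for x
  proof -
    from that have "aug_chain (int p - 1) X x \<and> pairing c x = of_int (h (pr x))"
    proof (induction x rule: aug_chain_induct)
      case zero
      have "h 0 = 0" using bd[of 0] by (simp add: aug_boundary_def)
      then show ?case by (simp add: pr_def c0 aug_boundary_def)
    next
      case (one s)
      then show ?case by (simp add: c_def)
    next
      case (diff x y)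
      then show ?case
        using assms(2)[of "pr x" "pr y"] pr[of x] pr[of y]
        by (simp add: aug_chain_diff pairing_diff pr_diff)
    qed
    then show ?thesis ..
  qed
  have pr_id: "pr x = x" if "aug_boundary (int p - 1) x = 0" for x
    using that by (simp add: pr_def c0)
  have "coboundary (int p - 1) X c s = 0" for s
  proof (cases "s \<in> aug_simplices (int p) X")
    case True
    then have s: "aug_chain (int p) X (frag_of s)" by simp
    have "coboundary (int p - 1) X c s = pairing c (aug_boundary (int p) (frag_of s))"
      using pairing_coboundary[OF cc, of "frag_of s"] s by simp
    also have "\<dots> = of_int (h (pr (aug_boundary (int p) (frag_of s))))"
      using aug_chain_boundary[OF s] by (rule c)
    also have "pr (aug_boundary (int p) (frag_of s)) = aug_boundary (int p) (frag_of s)"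
      using aug_boundary_boundary[of "int p - 1" X "frag_of s"] s by (simp add: pr_id)
    finally show ?thesis using bd[OF s] by simp
  qed (simp add: coboundary_def)
  then have "coboundary (int p - 1) X c = (\<lambda>s. 0)" by auto
  moreover note cc
  moreover assume "trivial_group
    (reduced_cohomology_group (int p - 1) X :: ('a sing_simplex \<Rightarrow> 'f::field) set monoid)"
  ultimately have "c \<in> coboundary_set (int p - 1) X"
    unfolding trivial_reduced_cohomology_group_iff by blast
  then obtain e where e: "c = coboundary (int p - 2) X e" "e \<in> carrier (cochain_group (int p - 2) X)"
    by (auto simp: coboundary_set_def)
  have "1 = pairing c z" using c[OF z(1)] z by (simp add: pr_id)
  also have "\<dots> = pairing e (aug_boundary (int p - 1) z)"
    using pairing_coboundary[OF e(2), of z] z(1) by (simp add: e(1))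
  finally show False using z(2) by simp
qed

section \<open>Reduced cohomology of contractible spaces and of spheres\<close>

lemma frag_extend_const_compose:
  "frag_extend (\<lambda>_. frag_of b) (frag_extend (\<lambda>_. frag_of a) c) = frag_extend (\<lambda>_. frag_of b) c"
  using frag_extend_compose[of "\<lambda>_. frag_of b" "\<lambda>_. a" c] by (simp add: o_def)

lemma aug_chain_nat: "aug_chain (int q) X x \<longleftrightarrow> singular_chain q X x"
  by (simp add: aug_chain_def singular_chain_def aug_simplices_def)

lemma aug_boundary_pos:
  assumes "0 < q"
  shows "aug_boundary (int q) = chain_boundary q"
proof -
  have "aug_face (int q) k s = singular_face q k s" for k and s :: "'a sing_simplex"
    using assms by (simp add: aug_face_def)
  then show ?thesis
    using assms by (intro ext) (simp add: aug_boundary_def chain_boundary_def)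
qed

text \<open>
  Cycles of the augmented complex are the cycles whose class lies in the reduced homology group. Only
  degree 0 has content: there the reduced group is the kernel of the map to the homology of a point,
  and on chains that map is the augmentation, because a point has no nonzero boundaries in degree 0.
\<close>

lemma aug_cycle_iff:
  "aug_chain (int q) X z \<and> aug_boundary (int q) z = 0 \<longleftrightarrow>
   singular_relcycle q X {} z \<and> homologous_rel_set q X {} z \<in> carrier (reduced_homology_group (int q) X)"
proof (cases "q = 0")
  case False
  then have "homologous_rel_set q X {} z \<in> carrier (reduced_homology_group (int q) X)"
    if "singular_relcycle q X {} z"
    using that by (auto simp: un_reduced_homology_group carrier_relative_homology_group)
  with False show ?thesis
    by (auto simp: aug_chain_nat aug_boundary_pos singular_cycle)
next
  case True
  let ?u = "\<lambda>_::nat \<Rightarrow> real. undefined :: 'a" and ?v = "\<lambda>_::nat \<Rightarrow> real. ()"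
  have aug: "aug_boundary 0 z = frag_extend (\<lambda>s. frag_of ?u) z"
    by (simp add: aug_boundary_def aug_face_def)
  have map: "chain_map 0 (\<lambda>x. ()) z = frag_extend (\<lambda>s. frag_of ?v) z"
  proof -
    have "frag_of \<circ> simplex_map 0 (\<lambda>x::'a. ()) = (\<lambda>s. frag_of ?v)"
      by (intro ext) (simp add: fun_eq_iff frag_of_eq)
    then show ?thesis by (simp add: chain_map_def)
  qed
  have eq: "chain_map 0 (\<lambda>x. ()) z = 0 \<longleftrightarrow> aug_boundary 0 z = 0"
  proof
    assume "chain_map 0 (\<lambda>x. ()) z = 0"
    then have "frag_extend (\<lambda>s. frag_of ?u) (frag_extend (\<lambda>s. frag_of ?v) z) = 0"
      by (simp add: map)
    then show "aug_boundary 0 z = 0"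
      by (simp add: aug frag_extend_const_compose)
  next
    assume "aug_boundary 0 z = 0"
    then have "frag_extend (\<lambda>s. frag_of ?v) (frag_extend (\<lambda>s. frag_of ?u) z) = 0"
      by (simp add: aug)
    then show "chain_map 0 (\<lambda>x. ()) z = 0"
      by (simp add: map frag_extend_const_compose)
  qed
  have "homologous_rel_set 0 X {} z \<in> carrier (reduced_homology_group 0 X) \<longleftrightarrow> chain_map 0 (\<lambda>x. ()) z = 0"
    if z: "singular_relcycle 0 X {} z"
  proof -
    let ?D = "discrete_topology {()}"
    have "homologous_rel_set 0 X {} z \<in> carrier (homology_group 0 X)"
      using z by (auto simp: carrier_relative_homology_group_0)
    moreover have "hom_induced 0 X {} ?D {} (\<lambda>x. ()) (homologous_rel_set 0 X {} z) =
        homologous_rel_set 0 ?D {} (chain_map 0 (\<lambda>x. ()) z)"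
      using hom_induced_chain_map[of X ?D "\<lambda>x. ()" "{}" "{}" 0 z] z by simp
    moreover have "\<one>\<^bsub>homology_group 0 ?D\<^esub> = singular_relboundary_set 0 ?D {}"
      using one_relative_homology_group[of 0 ?D "{}"] by simp
    moreover have "singular_relcycle 0 ?D {} (chain_map 0 (\<lambda>x. ()) z)"
      using singular_relcycle_chain_map[OF z, of ?D "\<lambda>x. ()" "{}"] by simp
    then have "singular_relboundary 0 ?D {} (chain_map 0 (\<lambda>x. ()) z) \<longleftrightarrow> chain_map 0 (\<lambda>x. ()) z = 0"
      using singular_boundary_singleton[of ?D "()" 0] by (auto simp: singular_relcycle_def)
    ultimately show ?thesis
      by (simp add: carrier_reduced_homology_group kernel_def homologous_rel_set_eq_relboundary)
  qed
  moreover have "singular_relcycle 0 X {} z \<longleftrightarrow> aug_chain 0 X z"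
    using aug_chain_nat[of 0 X z] by (simp add: singular_cycle chain_boundary_def)
  ultimately show ?thesis using True eq by auto
qed

lemma aug_exact_if_trivial_reduced_homology:
  assumes "trivial_group (reduced_homology_group (int q) X)"
  shows "aug_exact (int q) X"
  unfolding aug_exact_def
proof (intro allI impI)
  fix z assume "aug_chain (int q) X z \<and> aug_boundary (int q) z = 0"
  then have "homologous_rel_set q X {} z \<in> carrier (reduced_homology_group (int q) X)"
    by (simp add: aug_cycle_iff)
  then have "homologous_rel_set q X {} z = singular_relboundary_set q X {}"
    using assms by (simp add: trivial_group_def one_reduced_homology_group)
  then obtain y where "singular_chain (Suc q) X y" "chain_boundary (Suc q) y = z"
    by (auto simp: homologous_rel_set_eq_relboundary singular_boundary)
  moreover have "aug_boundary (int q + 1) y = chain_boundary (Suc q) y"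
    by (metis aug_boundary_pos zero_less_Suc of_nat_Suc add.commute)
  ultimately show "\<exists>y. aug_chain (int q + 1) X y \<and> aug_boundary (int q + 1) y = z"
    using aug_chain_nat[of "Suc q" X y]
    by (intro exI[of _ y]) (simp add: add.commute)
qed

lemma aug_exact_minus_1:
  assumes "topspace X \<noteq> {}"
  shows "aug_exact (-1) X"
  unfolding aug_exact_def
proof (intro allI impI)
  let ?u = "\<lambda>_::nat \<Rightarrow> real. undefined :: 'a"
  fix z assume z: "aug_chain (-1) X z \<and> aug_boundary (-1) z = 0"
  obtain a where "a \<in> topspace X" using assms by blast
  then have s: "singular_simplex 0 X (\<lambda>x\<in>standard_simplex 0. a)" (is "singular_simplex 0 X ?s")
    by (simp add: singular_simplex_def)
  define y where "y = frag_extend (\<lambda>t. frag_of ?s) z"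
  have "aug_chain 0 X y"
    unfolding y_def using z s
    by (intro aug_chain_extend[of "-1" X]) (auto simp: aug_simplices_def)
  moreover have "aug_boundary 0 y = frag_extend (\<lambda>s. frag_of ?u) z"
    by (simp add: aug_boundary_def aug_face_def y_def frag_extend_const_compose)
  moreover have "\<dots> = frag_extend frag_of z"
    using z by (intro frag_extend_eq) (auto simp: aug_chain_def aug_simplices_def)
  ultimately show "\<exists>y. aug_chain (-1 + 1) X y \<and> aug_boundary (-1 + 1) y = z"
    by (intro exI[of _ y]) (simp add: frag_expansion[symmetric])
qed

theorem trivial_reduced_cohomology_group_contractible:
  assumes "contractible_space X" "topspace X \<noteq> {}"
  shows "trivial_group (reduced_cohomology_group d X :: ('a sing_simplex \<Rightarrow> 'f::field) set monoid)"
proof (cases "-1 \<le> d")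
  case True
  then obtain p where p: "d = int p - 1"
    using nonneg_int_cases[of "d + 1"] by (metis add_diff_cancel_right' diff_ge_0_iff_ge
        diff_minus_eq_add)
  have "aug_exact (int q - 1) X" for q
  proof (cases q)
    case 0
    then show ?thesis using aug_exact_minus_1[OF assms(2)] by simp
  next
    case (Suc r)
    then show ?thesis
      using aug_exact_if_trivial_reduced_homology
        trivial_reduced_homology_group_contractible_space[OF assms(1), of "int r"] by simp
  qed
  then show ?thesis unfolding p by (rule trivial_reduced_cohomology_group_if_exact)
next
  case False
  then show ?thesis
    by (auto simp: trivial_reduced_cohomology_group_iff coboundary_set_def cochain_group_def
        aug_simplices_def coboundary_def fun_eq_iff image_iff)
qed

text \<open>
  The homomorphism from cycles to the integers is the isomorphism of the reduced homology of the
  sphere with the integers.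
\<close>

theorem nontrivial_reduced_cohomology_group_nsphere:
  assumes hs: "X homeomorphic_space nsphere n"
  shows "\<not> trivial_group (reduced_cohomology_group (int n) X :: ('a sing_simplex \<Rightarrow> 'f::field) set monoid)"
proof -
  let ?R = "reduced_homology_group (int n) X"
  have iso: "reduced_homology_group p X \<cong> reduced_homology_group p (nsphere n)" for p
    using hs by (rule homeomorphic_space_imp_isomorphic_reduced_homology_groups)
  have ne: "topspace X \<noteq> {}"
  proof
    assume "topspace X = {}"
    then have "trivial_group ?R" by (rule trivial_reduced_homology_group_empty)
    then have "trivial_group (reduced_homology_group (int n) (nsphere n))"
      using isomorphic_group_triviality[OF iso] by simp
    then show False by (simp add: trivial_reduced_homology_group_nsphere)
  qed
  have exact: "aug_exact (int q - 1) X" if "q < Suc n" for q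
  proof (cases q)
    case 0
    then show ?thesis using aug_exact_minus_1[OF ne] by simp
  next
    case (Suc r)
    then have "trivial_group (reduced_homology_group (int r) (nsphere n))"
      using that by (simp add: trivial_reduced_homology_group_nsphere)
    then have "trivial_group (reduced_homology_group (int r) X)"
      using isomorphic_group_triviality[OF iso] by simp
    then show ?thesis using aug_exact_if_trivial_reduced_homology Suc by simp
  qed
  have "?R \<cong> integer_group"
    using iso reduced_homology_group_nsphere(1) by (rule iso_trans)
  then obtain h where h: "h \<in> iso ?R integer_group" by (auto simp: is_iso_def)
  then interpret h: group_hom ?R integer_group h
    by (auto simp: group_hom_def group_hom_axioms_def iso_def)
  have h_mult: "h (a \<otimes>\<^bsub>?R\<^esub> b) = h a + h b" if "a \<in> carrier ?R" "b \<in> carrier ?R" for a b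
    using h.hom_mult[OF that] by simp
  let ?cls = "homologous_rel_set n X {}"
  have cls_add: "?cls (a + b) = ?cls a \<otimes>\<^bsub>?R\<^esub> ?cls b"
    if "singular_relcycle n X {} a" "singular_relcycle n X {} b" for a b
  proof -
    interpret normal "singular_relboundary_set n X {}" "relcycle_group n X {}"
      by (rule normal_subgroup_singular_relboundary_relcycle)
    have "singular_relboundary_set n X {} #>\<^bsub>relcycle_group n X {}\<^esub> (a + b) =
        (singular_relboundary_set n X {} #>\<^bsub>relcycle_group n X {}\<^esub> a) <#>\<^bsub>relcycle_group n X {}\<^esub>
        (singular_relboundary_set n X {} #>\<^bsub>relcycle_group n X {}\<^esub> b)"
      using rcos_sum[of a b] that by simp
    then show ?thesis
      by (simp add: right_coset_singular_relboundary reduced_homology_group_def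
          relative_homology_group_def FactGroup_def)
  qed
  have "\<exists>z. singular_relcycle n X {} z \<and> ?cls z \<in> carrier ?R \<and> h (?cls z) = 1"
  proof -
    have "h ` carrier ?R = UNIV"
      using h by (auto simp: iso_def bij_betw_def integer_group_def)
    then obtain g where g: "g \<in> carrier ?R" "h g = 1" by (metis UNIV_I imageE)
    then have "g \<in> carrier (homology_group (int n) X)"
      using carrier_reduced_homology_group_subset by blast
    then show ?thesis using g by (auto simp: carrier_relative_homology_group)
  qed
  then obtain z where z: "aug_chain (int n) X z" "aug_boundary (int n) z = 0" "h (?cls z) = 1"
    using aug_cycle_iff by metis
  have "\<not> trivial_group (reduced_cohomology_group (int (Suc n) - 1) X
      :: ('a sing_simplex \<Rightarrow> 'f::field) set monoid)"
  proof (rule nontrivial_reduced_cohomology_group_if_exact[of "Suc n" X "\<lambda>z. h (?cls z)" z])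
    show "aug_exact (int q - 1) X" if "q < Suc n" for q using that by (rule exact)
    show "h (?cls (x - y)) = h (?cls x) - h (?cls y)"
      if "aug_chain (int (Suc n) - 1) X x" "aug_boundary (int (Suc n) - 1) x = 0"
        "aug_chain (int (Suc n) - 1) X y" "aug_boundary (int (Suc n) - 1) y = 0" for x y
    proof -
      have "aug_chain (int n) X (x - y)" "aug_boundary (int n) (x - y) = 0"
        using that by (auto simp: aug_chain_diff aug_boundary_diff)
      then have "singular_relcycle n X {} (x - y) \<and> ?cls (x - y) \<in> carrier ?R"
        using aug_cycle_iff by blast
      moreover have "singular_relcycle n X {} y \<and> ?cls y \<in> carrier ?R"
        using that aug_cycle_iff[of n X y] by simp
      ultimately have "h (?cls (x - y + y)) = h (?cls (x - y)) + h (?cls y)"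
        using cls_add[of "x - y" y] h_mult by simp
      then show ?thesis by simp
    qed
    show "h (?cls (aug_boundary (int (Suc n)) y)) = 0" if "aug_chain (int (Suc n)) X y" for y
    proof -
      have "singular_relboundary n X {} (aug_boundary (int (Suc n)) y)"
        using that unfolding singular_boundary aug_chain_nat aug_boundary_pos[OF zero_less_Suc] by blast
      then have "?cls (aug_boundary (int (Suc n)) y) = \<one>\<^bsub>?R\<^esub>"
        by (simp add: one_reduced_homology_group homologous_rel_set_eq_relboundary)
      then show ?thesis using h.hom_one by (simp add: integer_group_def)
    qed
  qed (use z in auto)
  then show ?thesis by simp
qed

section \<open>Generic positions and exits through a single wall\<close>

lemma eventually_pos_perturb:
  fixes a c :: "'n::finite \<Rightarrow> real"
  shows "\<forall>\<^sub>F t in at_right 0. \<forall>j. 0 < a j \<longrightarrow> 0 < a j + t * c j"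
proof (intro eventually_all_finite)
  fix j
  have "((\<lambda>t. a j + t * c j) \<longlongrightarrow> a j + 0 * c j) (at_right 0)"
    by (intro tendsto_intros)
  then show "\<forall>\<^sub>F t in at_right 0. 0 < a j \<longrightarrow> 0 < a j + t * c j"
    by (cases "0 < a j") (auto dest: order_tendstoD(1)[of _ _ _ 0])
qed

lemma eventually_nonzero_perturb:
  fixes a c :: real
  assumes "a \<noteq> 0 \<or> c \<noteq> 0"
  shows "\<forall>\<^sub>F t in at_right 0. a + t * c \<noteq> 0"
proof (cases "a = 0")
  case True
  with assms have "c \<noteq> 0" by simp
  then have "a + t * c \<noteq> 0" if "0 < t" for t using that True by simp
  then show ?thesis by (auto simp: eventually_at_right_field intro: exI[of _ 1])
next
  case False
  have "((\<lambda>t. a + t * c) \<longlongrightarrow> a + 0 * c) (at_right 0)"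
    by (intro tendsto_intros)
  then show ?thesis using False by (auto dest: tendsto_imp_eventually_ne)
qed

lemma pos_perturb:
  fixes a c :: "'n::finite \<Rightarrow> real"
  obtains t where "0 < t" "\<And>j. 0 < a j \<Longrightarrow> 0 < a j + t * c j"
proof -
  have "\<forall>\<^sub>F t in at_right (0::real). 0 < t \<and> (\<forall>j. 0 < a j \<longrightarrow> 0 < a j + t * c j)"
    using eventually_at_right_less eventually_pos_perturb by (rule eventually_conj)
  then show thesis
    using that eventually_happens'[OF trivial_limit_at_right_real] by blast
qed

lemma generic_vector:
  fixes L :: "'a::euclidean_space set"
  assumes "subspace L" "finite V" "\<And>v. v \<in> V \<Longrightarrow> \<exists>x\<in>L. v \<bullet> x \<noteq> 0"
  shows "\<exists>h\<in>L. \<forall>v\<in>V. v \<bullet> h \<noteq> 0"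
  using assms(2,3)
proof (induction V)
  case empty
  then show ?case using subspace_0[OF assms(1)] by blast
next
  case (insert v V)
  then obtain h where h: "h \<in> L" "\<forall>v\<in>V. v \<bullet> h \<noteq> 0" by auto
  from insert.prems obtain x where x: "x \<in> L" "v \<bullet> x \<noteq> 0" by blast
  have "\<forall>\<^sub>F t in at_right 0. \<forall>w\<in>insert v V. w \<bullet> h + t * (w \<bullet> x) \<noteq> 0"
    using insert.hyps(1) h(2) x(2)
    by (intro eventually_ball_finite eventually_nonzero_perturb ballI) auto
  then obtain t where "\<forall>w\<in>insert v V. w \<bullet> h + t * (w \<bullet> x) \<noteq> 0"
    using eventually_happens'[OF trivial_limit_at_right_real] by blast
  then have "\<forall>w\<in>insert v V. w \<bullet> (h + t *\<^sub>R x) \<noteq> 0"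
    by (simp add: inner_add_right)
  moreover have "h + t *\<^sub>R x \<in> L"
    using assms(1) h(1) x(1) by (intro subspace_add subspace_scale)
  ultimately show ?case by blast
qed

text \<open>
  Walk from an interior point \<open>z\<close> of a cone to a point \<open>y\<close> outside, within the subspace \<open>L\<close>. After a
  perturbation of \<open>z\<close>, different traces of the bounding hyperplanes on \<open>L\<close> are crossed at different
  times, so the first crossing point \<open>e\<close> lies on one wall of the cone only.
\<close>

lemma exit_through_wall:
  fixes u :: "'n::finite \<Rightarrow> 'a::euclidean_space"
  assumes L: "subspace L" "z \<in> L" "y \<in> L"
    and z: "\<And>j. j \<in> J \<Longrightarrow> 0 < u j \<bullet> z"
    and y: "k \<in> J" "u k \<bullet> y < 0"
  shows "\<exists>i\<in>J. \<exists>e\<in>L. u i \<bullet> y < 0 \<and> u i \<bullet> e = 0 \<and>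
    (\<forall>j\<in>J. {x \<in> L. u j \<bullet> x = 0} \<noteq> {x \<in> L. u i \<bullet> x = 0} \<longrightarrow> 0 < u j \<bullet> e)"
proof -
  define N where "N = {j \<in> J. u j \<bullet> y < 0}"
  \<comment> \<open>The segment from \<open>x\<close> to \<open>y\<close> meets the hyperplanes of \<open>i\<close> and \<open>j\<close> at the same time if and only if
    \<open>v (i, j) \<bullet> x = 0\<close>.\<close>
  define v where "v = (\<lambda>(i, j). (u j \<bullet> y) *\<^sub>R u i - (u i \<bullet> y) *\<^sub>R u j)"
  define V where "V = {v (i, j) | i j. \<exists>x\<in>L. v (i, j) \<bullet> x \<noteq> 0}"
  have "V \<subseteq> range v" by (auto simp: V_def)
  then have finV: "finite V" by (rule finite_subset) simp
  obtain h where h: "h \<in> L" "\<forall>v\<in>V. v \<bullet> h \<noteq> 0"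
    using generic_vector[OF L(1) finV] unfolding V_def by blast
  have "\<forall>\<^sub>F t in at_right (0::real). \<forall>w\<in>V. w \<bullet> z + t * (w \<bullet> h) \<noteq> 0"
    using finV h(2) by (intro eventually_ball_finite eventually_nonzero_perturb ballI) auto
  moreover have "\<forall>\<^sub>F t in at_right 0. \<forall>j. 0 < u j \<bullet> z \<longrightarrow> 0 < u j \<bullet> z + t * (u j \<bullet> h)"
    by (rule eventually_pos_perturb)
  ultimately have "\<forall>\<^sub>F t in at_right 0. (\<forall>w\<in>V. w \<bullet> z + t * (w \<bullet> h) \<noteq> 0) \<and>
      (\<forall>j. 0 < u j \<bullet> z \<longrightarrow> 0 < u j \<bullet> z + t * (u j \<bullet> h))"
    by (rule eventually_conj)
  then obtain t where t: "\<forall>w\<in>V. w \<bullet> z + t * (w \<bullet> h) \<noteq> 0"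
      "\<forall>j. 0 < u j \<bullet> z \<longrightarrow> 0 < u j \<bullet> z + t * (u j \<bullet> h)"
    using eventually_happens'[OF trivial_limit_at_right_real] by blast
  define z' where "z' = z + t *\<^sub>R h"
  have z'L: "z' \<in> L" unfolding z'_def using L h(1) by (intro subspace_add subspace_scale)
  have z'V: "w \<bullet> z' \<noteq> 0" if "w \<in> V" for w
    using t(1) that by (simp add: z'_def inner_add_right)
  have z': "0 < u j \<bullet> z'" if "j \<in> J" for j
    using t(2) z[OF that] by (simp add: z'_def inner_add_right)
  \<comment> \<open>The time at which the segment from \<open>z'\<close> to \<open>y\<close> crosses the hyperplane of \<open>j\<close>.\<close>
  define T where "T j = (u j \<bullet> z') / (u j \<bullet> z' - u j \<bullet> y)" for j
  have "N \<noteq> {}" using y by (auto simp: N_def)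
  obtain i where i: "i \<in> N" "\<And>j. j \<in> N \<Longrightarrow> T i \<le> T j"
  proof -
    have "arg_min_on T N \<in> N" using \<open>N \<noteq> {}\<close> by (intro arg_min_if_finite) auto
    moreover have "T (arg_min_on T N) \<le> T j" if "j \<in> N" for j
      using that \<open>N \<noteq> {}\<close> by (intro arg_min_least) auto
    ultimately show thesis using that by blast
  qed
  have iJ: "i \<in> J" "u i \<bullet> y < 0" using i(1) by (auto simp: N_def)
  have T: "0 < T i" "T i < 1"
    using iJ z'[OF iJ(1)] by (auto simp: T_def field_simps)
  define e where "e = (1 - T i) *\<^sub>R z' + T i *\<^sub>R y"
  have ue: "u j \<bullet> e = u j \<bullet> z' - T i * (u j \<bullet> z' - u j \<bullet> y)" for j
    by (simp add: e_def inner_add_right algebra_simps)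
  show ?thesis
  proof (intro bexI[OF _ iJ(1)] bexI[of _ e] conjI ballI impI iJ(2))
    show "e \<in> L" unfolding e_def using L z'L by (intro subspace_add subspace_scale)
    show "u i \<bullet> e = 0" using iJ(2) z'[OF iJ(1)] by (simp add: ue T_def)
    fix j assume j: "j \<in> J" "{x \<in> L. u j \<bullet> x = 0} \<noteq> {x \<in> L. u i \<bullet> x = 0}"
    show "0 < u j \<bullet> e"
    proof (cases "u j \<bullet> y < 0")
      case False
      have "u j \<bullet> e = (1 - T i) * (u j \<bullet> z') + T i * (u j \<bullet> y)"
        by (simp add: ue algebra_simps)
      moreover have "0 < (1 - T i) * (u j \<bullet> z')" using T z'[OF j(1)] by simp
      moreover have "0 \<le> T i * (u j \<bullet> y)" using T False by simp
      ultimately show ?thesis by simp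
    next
      case True
      then have jN: "j \<in> N" using j by (simp add: N_def)
      have pos: "0 < u j \<bullet> z' - u j \<bullet> y" "0 < u i \<bullet> z' - u i \<bullet> y"
        using True z'[OF j(1)] z'[OF iJ(1)] iJ(2) by auto
      have "T i \<noteq> T j"
      proof
        assume "T i = T j"
        then have "(u i \<bullet> z') * (u j \<bullet> z' - u j \<bullet> y) = (u j \<bullet> z') * (u i \<bullet> z' - u i \<bullet> y)"
          using pos by (simp add: T_def frac_eq_eq)
        then have "v (i, j) \<bullet> z' = 0"
          by (simp add: v_def inner_diff_left algebra_simps)
        then have "v (i, j) \<notin> V" using z'V by blast
        \<comment> \<open>So \<open>u i\<close> and \<open>u j\<close> are proportional on \<open>L\<close>.\<close>
        then have v0: "v (i, j) \<bullet> x = 0" if "x \<in> L" for x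
          using that unfolding V_def by blast
        have "u j \<bullet> x = 0 \<longleftrightarrow> u i \<bullet> x = 0" if "x \<in> L" for x
          using v0[OF that] True iJ(2) by (auto simp: v_def inner_diff_left)
        then show False using j(2) by auto
      qed
      then have "T i < T j" using i(2)[OF jN] by simp
      then have "T i * (u j \<bullet> z' - u j \<bullet> y) < T j * (u j \<bullet> z' - u j \<bullet> y)"
        using pos(1) by (rule mult_strict_right_mono)
      also have "\<dots> = u j \<bullet> z'" using pos(1) by (simp add: T_def)
      finally show ?thesis by (simp add: ue)
    qed
  qed
qed

section \<open>Polyhedral cones\<close>

definition closed_cone :: "('n \<Rightarrow> 'a::real_inner) \<Rightarrow> 'a set" where
  "closed_cone u = {x. \<forall>i. 0 \<le> u i \<bullet> x}"

definition open_cone :: "('n \<Rightarrow> 'a::real_inner) \<Rightarrow> 'a set" where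
  "open_cone u = {x. \<forall>i. 0 < u i \<bullet> x}"

lemma closed_cone_Inter: "closed_cone u = (\<Inter>i. {x. 0 \<le> u i \<bullet> x})"
  by (auto simp: closed_cone_def)

lemma open_cone_Inter: "open_cone u = (\<Inter>i. {x. 0 < u i \<bullet> x})"
  by (auto simp: open_cone_def)

lemma convex_closed_cone: "convex (closed_cone u)"
  unfolding closed_cone_Inter by (intro convex_INT convex_halfspace_ge)

lemma closed_closed_cone: "closed (closed_cone u)"
  unfolding closed_cone_Inter by (intro closed_INT ballI closed_halfspace_ge)

lemma closed_cone_scale: "x \<in> closed_cone u \<Longrightarrow> 0 \<le> c \<Longrightarrow> c *\<^sub>R x \<in> closed_cone u"
  by (simp add: closed_cone_def)

lemma interior_closed_cone:
  fixes u :: "'n::finite \<Rightarrow> 'a::euclidean_space"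
  assumes "\<And>i. u i \<noteq> 0"
  shows "interior (closed_cone u) = open_cone u"
proof
  have "interior (closed_cone u) \<subseteq> {x. 0 < u i \<bullet> x}" for i
  proof -
    have "closed_cone u \<subseteq> {x. u i \<bullet> x \<ge> 0}" by (auto simp: closed_cone_def)
    then show ?thesis using interior_mono interior_halfspace_ge[OF assms] by blast
  qed
  then show "interior (closed_cone u) \<subseteq> open_cone u" unfolding open_cone_Inter by blast
  have "open (open_cone u)"
    unfolding open_cone_Inter by (intro open_INT finite ballI open_halfspace_gt)
  moreover have "open_cone u \<subseteq> closed_cone u"
    by (auto simp: open_cone_def closed_cone_def less_imp_le)
  ultimately show "open_cone u \<subseteq> interior (closed_cone u)" by (rule interior_maximal[rotated])
qed

lemma closure_open_cone:
  fixes u :: "'n::finite \<Rightarrow> 'a::euclidean_space"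
  assumes "\<And>i. u i \<noteq> 0" "open_cone u \<noteq> {}"
  shows "closure (open_cone u) = closed_cone u"
proof -
  have "interior (closed_cone u) = open_cone u" using assms(1) by (rule interior_closed_cone)
  then show ?thesis
    using convex_closure_interior[OF convex_closed_cone, of u] closed_closed_cone[of u] assms(2)
    by simp
qed

text \<open>
  For a cone with interior points, this says that the hyperplane of \<open>u i\<close> spans a facet: some
  point of the hyperplane satisfies strictly all constraints that come from other hyperplanes.
  Constraints with the same hyperplane are exempt, so that repeated and opposite normals cause no
  special cases.
\<close>

definition is_wall :: "('n \<Rightarrow> 'a::real_inner) \<Rightarrow> 'n \<Rightarrow> bool" where
  "is_wall u i \<longleftrightarrow>
     (\<exists>e. u i \<bullet> e = 0 \<and> (\<forall>j. {x. u j \<bullet> x = 0} \<noteq> {x. u i \<bullet> x = 0} \<longrightarrow> 0 < u j \<bullet> e))"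

lemma span_Int_sphere:
  fixes F :: "'a::real_normed_vector set"
  assumes "\<And>x c. x \<in> F \<Longrightarrow> 0 \<le> c \<Longrightarrow> c *\<^sub>R x \<in> F"
  shows "span (F \<inter> sphere 0 1) = span F"
proof
  show "span (F \<inter> sphere 0 1) \<subseteq> span F" by (intro span_mono) auto
  have "x \<in> span (F \<inter> sphere 0 1)" if "x \<in> F" for x
  proof (cases "x = 0")
    case False
    then have "inverse (norm x) *\<^sub>R x \<in> F \<inter> sphere 0 1" using assms that by auto
    then have "norm x *\<^sub>R (inverse (norm x) *\<^sub>R x) \<in> span (F \<inter> sphere 0 1)"
      by (intro span_scale span_base)
    then show ?thesis using False by simp
  qed (simp add: span_zero)
  then show "span F \<subseteq> span (F \<inter> sphere 0 1)" by (intro span_minimal) auto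
qed

text \<open>
  Around the witness \<open>e\<close> the hyperplane stays in the cone, hence the face spans the hyperplane and has
  codimension one.
\<close>

lemma wall_facet:
  fixes u :: "'n::finite \<Rightarrow> 'a::euclidean_space"
  assumes u: "\<And>i. u i \<noteq> 0" and ne: "open_cone u \<noteq> {}" and wall: "is_wall u i"
  shows "(closed_cone u \<inter> {x. u i \<bullet> x = 0}) facet_of closed_cone u"
    and "span (closed_cone u \<inter> {x. u i \<bullet> x = 0}) = {x. u i \<bullet> x = 0}"
proof -
  let ?F = "closed_cone u \<inter> {x. u i \<bullet> x = 0}"
  obtain e where e: "u i \<bullet> e = 0"
    "\<And>j. {x. u j \<bullet> x = 0} \<noteq> {x. u i \<bullet> x = 0} \<Longrightarrow> 0 < u j \<bullet> e"
    using wall unfolding is_wall_def by blast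
  have zero: "u j \<bullet> x = 0" if "\<not> 0 < u j \<bullet> e" "u i \<bullet> x = 0" for j x
    using e(2)[of j] that by blast
  have "h \<in> span ?F" if h: "u i \<bullet> h = 0" for h
  proof -
    obtain t where t: "0 < t" "\<And>j. 0 < u j \<bullet> e \<Longrightarrow> 0 < u j \<bullet> e + t * (u j \<bullet> h)"
      using pos_perturb[of "\<lambda>j. u j \<bullet> e" "\<lambda>j. u j \<bullet> h"] by blast
    have "0 \<le> u j \<bullet> (e + t *\<^sub>R h)" for j
      using t(2)[of j] zero[of j e] zero[of j h] e(1) h
      by (cases "0 < u j \<bullet> e") (auto simp: inner_add_right)
    then have 1: "e + t *\<^sub>R h \<in> ?F" using e(1) h by (simp add: closed_cone_def inner_add_right)
    have "0 \<le> u j \<bullet> e" for j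
      using zero[of j e] e(1) by (cases "0 < u j \<bullet> e") auto
    then have 2: "e \<in> ?F" using e(1) by (simp add: closed_cone_def)
    have "inverse t *\<^sub>R ((e + t *\<^sub>R h) - e) \<in> span ?F"
      using 1 2 by (intro span_scale span_diff span_base)
    then show ?thesis using t(1) by simp
  qed
  moreover have "subspace {x. u i \<bullet> x = 0}" by (rule subspace_hyperplane)
  ultimately show span: "span ?F = {x. u i \<bullet> x = 0}"
    by (intro subset_antisym span_minimal) auto
  have 0: "0 \<in> ?F" by (simp add: closed_cone_def)
  then have "aff_dim ?F = int (dim ?F)"
    by (intro aff_dim_zero hull_inc)
  also have "dim ?F = DIM('a) - 1"
    using span dim_span[of ?F] dim_hyperplane[OF u[of i]] by simp
  also have "int (DIM('a) - 1) = aff_dim (closed_cone u) - 1"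
    using aff_dim_nonempty_interior[of "closed_cone u"] ne DIM_positive[where 'a='a]
    by (simp add: interior_closed_cone[OF u] of_nat_diff)
  finally show "?F facet_of closed_cone u"
    unfolding facet_of_def
  proof (intro conjI)
    show "?F face_of closed_cone u"
      by (rule face_of_Int_supporting_hyperplane_ge[OF convex_closed_cone]) (simp add: closed_cone_def)
    show "?F \<noteq> {}" using 0 by blast
  qed
qed

section \<open>Regions and visible facets of an arrangement\<close>

definition signed_rows :: "real^'k^'n \<Rightarrow> ('n \<Rightarrow> real) \<Rightarrow> 'n \<Rightarrow> real^'k" where
  "signed_rows W b i = b i *\<^sub>R row i W"

lemma signed_rows_inner [simp]: "signed_rows W b i \<bullet> x = b i * (row i W \<bullet> x)"
  by (simp add: signed_rows_def)

lemma region_iff: "x \<in> region W b \<longleftrightarrow> (\<forall>i. sgn (row i W \<bullet> x) = b i)"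
  by (simp add: region_def matrix_vector_mul_component row_def vec_lambda_eta)

lemma region_eq_open_cone:
  assumes "\<And>i. b i \<in> {-1, 1}"
  shows "region W b = open_cone (signed_rows W b)"
proof -
  have "sgn r = b i \<longleftrightarrow> 0 < b i * r" for i and r :: real
  proof -
    consider "b i = -1" | "b i = 1" using assms[of i] by auto
    then show ?thesis by cases (simp_all add: sgn_1_neg sgn_1_pos)
  qed
  then show ?thesis by (auto simp: region_iff open_cone_def)
qed

lemma hyperplane_signed:
  assumes "\<And>i. b i \<in> {-1, 1::real}"
  shows "{x. signed_rows W b i \<bullet> x = 0} = hyperplane W i"
  using assms[of i] by (auto simp: hyperplane_def)

lemma signed_rows_nonzero:
  assumes "\<And>i. b i \<in> {-1, 1}" "\<And>i. row i W \<noteq> 0"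
  shows "signed_rows W b i \<noteq> 0"
  using assms(1)[of i] assms(2)[of i] by (auto simp: signed_rows_def)

lemma closure_region:
  fixes W :: "real^'k^'n"
  assumes b: "\<And>i. b i \<in> {-1, 1}" and "\<And>i. row i W \<noteq> 0" and "region W b \<noteq> {}"
  shows "closure (region W b) = closed_cone (signed_rows W b)"
proof -
  have "signed_rows W b i \<noteq> 0" for i using b assms(2) by (rule signed_rows_nonzero)
  then show ?thesis
    using closure_open_cone[of "signed_rows W b"] assms(3) region_eq_open_cone[of b W, OF b] by simp
qed

lemma in_Lambda_if_wall:
  fixes W :: "real^'k^'n"
  assumes b: "\<And>i. b i \<in> {-1, 1}" and W: "\<And>i. row i W \<noteq> 0" and ne: "region W b \<noteq> {}"
    and x: "x \<in> closed_cone (signed_rows W b)" "norm x = 1" "row i W \<bullet> x = 0"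
    and i: "b i = -1" "is_wall (signed_rows W b) i"
  shows "x \<in> Lambda W b"
proof -
  let ?u = "signed_rows W b"
  let ?F = "closed_cone ?u \<inter> hyperplane W i"
  have u: "?u j \<noteq> 0" for j using b W by (rule signed_rows_nonzero)
  have ne': "open_cone ?u \<noteq> {}" using ne region_eq_open_cone[of b W, OF b] by simp
  have h: "{x. ?u i \<bullet> x = 0} = hyperplane W i" by (rule hyperplane_signed[OF b])
  have "?F facet_of closure (region W b)" "span ?F = hyperplane W i"
    using wall_facet[of ?u, OF u ne' i(2)] unfolding h closure_region[OF b W ne] by blast+
  moreover have "span (?F \<inter> sphere 0 1) = span ?F"
  proof (rule span_Int_sphere)
    fix y :: "real^'k" and c :: real assume "y \<in> ?F" "0 \<le> c"
    then show "c *\<^sub>R y \<in> ?F" using closed_cone_scale[of y ?u c] by (simp add: hyperplane_def)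
  qed
  moreover have "separates W i b"
  proof -
    have "row i W \<bullet> y < 0" if "y \<in> region W b" for y
    proof -
      have "sgn (row i W \<bullet> y) = -1" using that i(1) unfolding region_iff by metis
      then show ?thesis by (simp add: sgn_1_neg)
    qed
    moreover have "0 < row i W \<bullet> y" if "y \<in> region W (\<lambda>_. 1)" for y
    proof -
      have "sgn (row i W \<bullet> y) = 1" using that unfolding region_iff by metis
      then show ?thesis by (simp add: sgn_1_pos)
    qed
    ultimately show ?thesis unfolding separates_def by blast
  qed
  moreover have "x \<in> ?F \<inter> sphere 0 1" using x by (simp add: hyperplane_def)
  ultimately show ?thesis
    unfolding Lambda_def by (intro UnionI[of "?F \<inter> sphere 0 1"] CollectI exI[of _ ?F] exI[of _ i] conjI) simp_all
qed

text \<open>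
  A facet that \<open>\<Lambda>\<close> collects separates, so its normal is negative on the region, which is nonempty as it
  has a facet.
\<close>

lemma in_LambdaD:
  fixes W :: "real^'k^'n"
  assumes b: "\<And>i. b i \<in> {-1, 1}" and x: "x \<in> Lambda W b"
  shows "region W b \<noteq> {}" "x \<in> closure (region W b)" "norm x = 1" "\<exists>i. b i = -1 \<and> row i W \<bullet> x = 0"
proof -
  obtain G where G: "x \<in> G" "\<exists>F. F facet_of closure (region W b) \<and> G = F \<inter> sphere 0 1 \<and>
      (\<exists>i. span G = hyperplane W i \<and> separates W i b)"
    using x unfolding Lambda_def by (elim UnionE CollectE)
  from G(2) obtain F i where F: "F facet_of closure (region W b)" "G = F \<inter> sphere 0 1"
    and i: "span G = hyperplane W i" "separates W i b"
    by (elim exE conjE)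
  show xc: "x \<in> closure (region W b)"
    using facet_of_imp_subset[OF F(1)] G(1) F(2) by auto
  show "norm x = 1" using F(2) G(1) by simp
  show ne: "region W b \<noteq> {}"
  proof
    assume "region W b = {}"
    then show False using xc by simp
  qed
  then obtain r where r: "r \<in> region W b" by blast
  then have "row i W \<bullet> r < 0" using i(2) by (auto simp: separates_def)
  then have "sgn (row i W \<bullet> r) = -1" by simp
  moreover have "sgn (row i W \<bullet> r) = b i" using r unfolding region_iff by blast
  ultimately have "b i = -1" by metis
  moreover have "x \<in> hyperplane W i" using span_base[OF G(1)] i(1) by simp
  ultimately show "\<exists>i. b i = -1 \<and> row i W \<bullet> x = 0" by (auto simp: hyperplane_def)
qed

text \<open>
  If \<open>R\<^sub>+\<close> is nonempty, an active minus constraint at \<open>x\<close> puts \<open>x\<close> into \<open>\<Lambda>(b)\<close>, even when its hyperplane does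
  not span a facet. The cone of the constraints active at \<open>x\<close> does not contain \<open>p\<close>, and on the
  way to \<open>p\<close> only minus constraints can fail, so it is left through a wall with a minus sign.
  A small shift of \<open>x\<close> towards the exit point shows that this is also a wall of the whole cone.
\<close>

lemma active_in_Lambda:
  fixes W :: "real^'k^'n"
  assumes b: "\<And>i. b i \<in> {-1, 1}" and W: "\<And>i. row i W \<noteq> 0" and ne: "region W b \<noteq> {}"
    and p: "p \<in> region W (\<lambda>_. 1)"
    and x: "x \<in> closed_cone (signed_rows W b)" "norm x = 1"
    and k: "b k = -1" "row k W \<bullet> x = 0"
  shows "x \<in> Lambda W b"
proof -
  let ?u = "signed_rows W b"
  define J where "J = {j. row j W \<bullet> x = 0}"
  obtain z where "z \<in> region W b" using ne by blast
  then have z: "0 < ?u j \<bullet> z" for j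
    unfolding region_eq_open_cone[of b W, OF b] open_cone_def by blast
  have wp: "0 < row j W \<bullet> p" for j
  proof -
    have "sgn (row j W \<bullet> p) = 1" using p unfolding region_iff by blast
    then show ?thesis by (simp add: sgn_1_pos)
  qed
  have kJ: "k \<in> J" and kp: "?u k \<bullet> p < 0" using k wp[of k] by (simp_all add: J_def)
  obtain i e where i: "i \<in> J" "?u i \<bullet> p < 0" "?u i \<bullet> e = 0" and
    e: "\<forall>j\<in>J. {x \<in> UNIV. ?u j \<bullet> x = 0} \<noteq> {x \<in> UNIV. ?u i \<bullet> x = 0} \<longrightarrow> 0 < ?u j \<bullet> e"
    using exit_through_wall[of UNIV z p J ?u k, OF subspace_UNIV UNIV_I UNIV_I z kJ kp]
    by (elim bexE conjE)
  have bi: "b i = -1"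
    using i(2) wp[of i] b[of i] by auto
  obtain t where t: "0 < t" "\<And>j. 0 < ?u j \<bullet> x \<Longrightarrow> 0 < ?u j \<bullet> x + t * (?u j \<bullet> e)"
    using pos_perturb[of "\<lambda>j. ?u j \<bullet> x" "\<lambda>j. ?u j \<bullet> e"] by blast
  have ix: "row i W \<bullet> x = 0" using i(1) by (simp add: J_def)
  have "is_wall ?u i"
    unfolding is_wall_def
  proof (intro exI[of _ "x + t *\<^sub>R e"] conjI allI impI)
    show "?u i \<bullet> (x + t *\<^sub>R e) = 0"
      using i(3) ix by (simp add: inner_add_right)
    fix j assume j: "{x. ?u j \<bullet> x = 0} \<noteq> {x. ?u i \<bullet> x = 0}"
    have split: "?u j \<bullet> (x + t *\<^sub>R e) = ?u j \<bullet> x + t * (?u j \<bullet> e)"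
      by (simp only: inner_add_right inner_scaleR_right)
    show "0 < ?u j \<bullet> (x + t *\<^sub>R e)"
    proof (cases "j \<in> J")
      case True
      then have "?u j \<bullet> x = 0" by (simp add: J_def)
      moreover have "0 < ?u j \<bullet> e" using e True j by simp
      ultimately show ?thesis unfolding split using t(1) by (simp del: signed_rows_inner)
    next
      case False
      then have "?u j \<bullet> x \<noteq> 0" using b[of j] by (auto simp: J_def)
      moreover have "0 \<le> ?u j \<bullet> x" using x(1) by (simp only: closed_cone_def mem_Collect_eq)
      ultimately show ?thesis unfolding split by (intro t(2)) linarith
    qed
  qed
  with bi ix show ?thesis by (intro in_Lambda_if_wall[OF b W ne x])
qed

section \<open>A region whose boundary in the subspace is entirely visible\<close>

definition indices_with_trace :: "real^'k^'n \<Rightarrow> (real^'k) set \<Rightarrow> (real^'k) set \<Rightarrow> 'n set" where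
  "indices_with_trace W L M = {j. L \<inter> hyperplane W j = M}"

text \<open>
  The hyperplanes that cut \<open>L\<close> in \<open>M\<close>, with the signs of \<open>b\<close>, bound a cone whose lineality space
  contains \<open>M\<close>. The condition says that this cone has a wall with a minus sign. If the closure of the
  region contains a point of \<open>M\<close> that lies on no other hyperplane, then the two cones agree near this
  point, so that wall is a wall of the region and contains the point.
\<close>

definition visible_trace :: "real^'k^'n \<Rightarrow> (real^'k) set \<Rightarrow> ('n \<Rightarrow> real) \<Rightarrow> (real^'k) set \<Rightarrow> bool" where
  "visible_trace W L b M \<longleftrightarrow>
     (\<exists>j\<in>indices_with_trace W L M. b j = -1 \<and> (\<exists>e. row j W \<bullet> e = 0 \<and>
        (\<forall>m\<in>indices_with_trace W L M. hyperplane W m \<noteq> hyperplane W j \<longrightarrow> 0 < b m * (row m W \<bullet> e))))"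

lemma visible_trace_cong:
  assumes "\<And>j. j \<in> indices_with_trace W L M \<Longrightarrow> b j = b' j"
  shows "visible_trace W L b M \<longleftrightarrow> visible_trace W L b' M"
  using assms unfolding visible_trace_def by (simp cong: bex_cong ball_cong)

text \<open>
  The two cones are negatives of each other and have the same walls. A wall that has no minus sign
  on one side has one on the other.
\<close>

lemma visible_trace_opposite:
  assumes b: "\<And>i. b i \<in> {-1, 1}" and z: "z \<in> region W b" and k: "k \<in> indices_with_trace W L M"
  shows "visible_trace W L b M \<or> visible_trace W L (\<lambda>i. - b i) M"
proof -
  let ?u = "signed_rows W b" and ?J = "indices_with_trace W L M"
  have z: "0 < ?u j \<bullet> z" for j
    using z unfolding region_eq_open_cone[of b W, OF b] open_cone_def by blast
  have kz: "?u k \<bullet> (- z) < 0" using z[of k] by (simp del: signed_rows_inner)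
  obtain i e where i: "i \<in> ?J" "?u i \<bullet> e = 0" and
    e: "\<forall>j\<in>?J. {x \<in> UNIV. ?u j \<bullet> x = 0} \<noteq> {x \<in> UNIV. ?u i \<bullet> x = 0} \<longrightarrow> 0 < ?u j \<bullet> e"
    using exit_through_wall[of UNIV z "- z" ?J ?u k, OF subspace_UNIV UNIV_I UNIV_I z k kz] by (elim bexE conjE)
  have "{x \<in> UNIV. ?u j \<bullet> x = 0} = hyperplane W j" for j
    using hyperplane_signed[of b W j, OF b] by simp
  then have e: "0 < b j * (row j W \<bullet> e)" if "j \<in> ?J" "hyperplane W j \<noteq> hyperplane W i" for j
    using e that by simp
  have ie: "row i W \<bullet> e = 0" using i(2) b[of i] by auto
  consider "b i = -1" | "b i = 1" using b[of i] by auto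
  then show ?thesis
  proof cases
    case 1
    then have "visible_trace W L b M"
      unfolding visible_trace_def using i(1) ie e by blast
    then show ?thesis ..
  next
    case 2
    have "visible_trace W L (\<lambda>i. - b i) M"
      unfolding visible_trace_def
    proof (intro bexI[OF _ i(1)] conjI exI[of _ "- e"] ballI impI)
      show "- b i = -1" using 2 by simp
      show "row i W \<bullet> (- e) = 0" using ie by simp
      fix m assume "m \<in> ?J" "hyperplane W m \<noteq> hyperplane W i"
      then show "0 < - b m * (row m W \<bullet> - e)" using e by simp
    qed
    then show ?thesis ..
  qed
qed

text \<open>
  Choose a region meeting \<open>L\<close> for which the number of hidden traces is least. Given a boundary point
  \<open>x\<close> of the region in \<open>L\<close>, an exit point \<open>e\<close> of the cone at \<open>x\<close>, taken within \<open>L\<close>, leads to a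
  nearby \<open>y = x + t e\<close> that lies on a single trace \<open>M\<close>. Crossing \<open>M\<close> at \<open>y\<close> reverses exactly the signs of
  the hyperplanes through \<open>M\<close>, which changes the visibility of \<open>M\<close> alone. So \<open>M\<close> is visible by
  minimality, and the wall with a minus sign that witnesses this contains \<open>x\<close>.
\<close>

lemma exists_region_with_visible_boundary:
  fixes W :: "real^'k^'n"
  assumes W: "\<And>i. row i W \<noteq> 0" and L: "subspace L" "\<And>i. \<not> L \<subseteq> hyperplane W i"
  obtains b where "\<And>i. b i \<in> {-1, 1}" "L \<inter> region W b \<noteq> {}"
    "\<And>x k. x \<in> L \<Longrightarrow> x \<in> closed_cone (signed_rows W b) \<Longrightarrow> norm x = 1 \<Longrightarrow> row k W \<bullet> x = 0 \<Longrightarrow> x \<in> Lambda W b"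
proof -
  let ?traces = "range (\<lambda>i. L \<inter> hyperplane W i)"
  define hidden where "hidden b = {M \<in> ?traces. \<not> visible_trace W L b M}" for b
  define P where "P b \<longleftrightarrow> (\<forall>i. b i \<in> {-1, 1}) \<and> L \<inter> region W b \<noteq> {}" for b
  have "\<exists>x\<in>L. row i W \<bullet> x \<noteq> 0" for i
    using L(2)[of i] by (auto simp: hyperplane_def)
  then have "\<exists>h\<in>L. \<forall>v\<in>range (\<lambda>i. row i W). v \<bullet> h \<noteq> 0"
    by (intro generic_vector L(1)) auto
  then obtain h where h: "h \<in> L" "\<And>i. row i W \<bullet> h \<noteq> 0" by blast
  have "P (\<lambda>i. sgn (row i W \<bullet> h))"
  proof -
    have "h \<in> region W (\<lambda>i. sgn (row i W \<bullet> h))" by (simp add: region_iff)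
    then show ?thesis using h by (auto simp: P_def sgn_if)
  qed
  then obtain b where "P b" and min: "\<And>b'. P b' \<Longrightarrow> card (hidden b) \<le> card (hidden b')"
    using ex_has_least_nat[of P _ "\<lambda>b. card (hidden b)"] by blast
  then have b: "\<And>i. b i \<in> {-1, 1}" and ne: "L \<inter> region W b \<noteq> {}" by (auto simp: P_def)
  let ?u = "signed_rows W b"
  obtain z where zL: "z \<in> L" and zb: "z \<in> region W b" using ne by blast
  have z: "0 < ?u j \<bullet> z" for j
    using zb unfolding region_eq_open_cone[of b W, OF b] open_cone_def by blast
  have "x \<in> Lambda W b"
    if x: "x \<in> L" "x \<in> closed_cone ?u" "norm x = 1" and k: "row k W \<bullet> x = 0" for x k
  proof -
    define J where "J = {j. row j W \<bullet> x = 0}"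
    have kz: "?u k \<bullet> (- z) < 0" using z[of k] by (simp del: signed_rows_inner)
    have kJ: "k \<in> J" and mzL: "- z \<in> L" using k zL L(1) by (simp_all add: J_def subspace_neg)
    obtain i e where i: "i \<in> J" "?u i \<bullet> e = 0" and eL: "e \<in> L" and
      e: "\<forall>j\<in>J. {x \<in> L. ?u j \<bullet> x = 0} \<noteq> {x \<in> L. ?u i \<bullet> x = 0} \<longrightarrow> 0 < ?u j \<bullet> e"
      using exit_through_wall[of L z "- z" J ?u k, OF L(1) zL mzL z kJ kz] by (elim bexE conjE)
    define M where "M = L \<inter> hyperplane W i"
    let ?I = "indices_with_trace W L M"
    have Lu: "{x \<in> L. ?u j \<bullet> x = 0} = L \<inter> hyperplane W j" for j
      using hyperplane_signed[of b W j, OF b] by blast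
    have iI: "i \<in> ?I" by (simp add: indices_with_trace_def M_def)
    have eM: "e \<in> M" using i(2) eL Lu[of i] unfolding M_def by blast
    have xM: "x \<in> M" using i(1) x(1) by (simp add: M_def J_def hyperplane_def)
    have I0: "row j W \<bullet> x = 0" "row j W \<bullet> e = 0" if "j \<in> ?I" for j
      using xM eM that by (auto simp: indices_with_trace_def hyperplane_def)
    obtain t where t: "0 < t" "\<And>j. 0 < ?u j \<bullet> x \<Longrightarrow> 0 < ?u j \<bullet> x + t * (?u j \<bullet> e)"
      using pos_perturb[of "\<lambda>j. ?u j \<bullet> x" "\<lambda>j. ?u j \<bullet> e"] by blast
    define y where "y = x + t *\<^sub>R e"
    have yL: "y \<in> L" unfolding y_def using L(1) x(1) eL by (intro subspace_add subspace_scale)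
    have yI: "row j W \<bullet> y = 0" if "j \<in> ?I" for j
      using I0[OF that] by (simp add: y_def inner_add_right)
    have y_pos: "0 < ?u j \<bullet> y" if "j \<notin> ?I" for j
    proof -
      have split: "?u j \<bullet> y = ?u j \<bullet> x + t * (?u j \<bullet> e)"
        unfolding y_def by (simp only: inner_add_right inner_scaleR_right)
      show ?thesis
      proof (cases "j \<in> J")
        case True
        then have "?u j \<bullet> x = 0" by (simp add: J_def)
        moreover have "0 < ?u j \<bullet> e"
          using e True that unfolding Lu indices_with_trace_def M_def by blast
        ultimately show ?thesis unfolding split using t(1) by (simp del: signed_rows_inner)
      next
        case False
        then have "?u j \<bullet> x \<noteq> 0" using b[of j] by (auto simp: J_def)
        moreover have "0 \<le> ?u j \<bullet> x" using x(2) by (simp only: closed_cone_def mem_Collect_eq)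
        ultimately show ?thesis unfolding split by (intro t(2)) linarith
      qed
    qed
    have "visible_trace W L b M"
    proof (rule ccontr)
      assume hid: "\<not> visible_trace W L b M"
      define b' where "b' j = (if j \<in> ?I then - b j else b j)" for j
      have b': "b' j \<in> {-1, 1}" for j using b[of j] by (auto simp: b'_def)
      obtain s where s: "0 < s" "\<And>j. 0 < ?u j \<bullet> y \<Longrightarrow> 0 < ?u j \<bullet> y + s * - (?u j \<bullet> z)"
        using pos_perturb[of "\<lambda>j. ?u j \<bullet> y" "\<lambda>j. - (?u j \<bullet> z)"] by blast
      \<comment> \<open>A point just beyond \<open>M\<close>, seen from \<open>z\<close>.\<close>
      define y' where "y' = y - s *\<^sub>R z"
      have "y' \<in> L" unfolding y'_def using L(1) yL zL by (intro subspace_diff subspace_scale)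
      moreover have "0 < signed_rows W b' j \<bullet> y'" for j
      proof (cases "j \<in> ?I")
        case True
        then have "signed_rows W b' j \<bullet> y' = s * (?u j \<bullet> z)"
          using yI[OF True] by (simp add: b'_def y'_def inner_diff_right)
        then show ?thesis using s(1) z[of j] by (simp del: signed_rows_inner)
      next
        case False
        then have "signed_rows W b' j \<bullet> y' = ?u j \<bullet> y + s * - (?u j \<bullet> z)"
          by (simp add: b'_def y'_def inner_diff_right algebra_simps)
        then show ?thesis using s(2)[OF y_pos[OF False]] by (simp del: signed_rows_inner)
      qed
      then have "y' \<in> region W b'"
        unfolding region_eq_open_cone[of b' W, OF b'] open_cone_def by blast
      ultimately have "P b'" using b' unfolding P_def by blast
      then have le: "card (hidden b) \<le> card (hidden b')" by (rule min)
      have "visible_trace W L (\<lambda>i. - b i) M"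
        using visible_trace_opposite[OF b zb iI] hid by blast
      then have vis: "visible_trace W L b' M"
        using visible_trace_cong[of W L M "\<lambda>i. - b i" b'] by (simp add: b'_def)
      have "hidden b' \<subseteq> hidden b - {M}"
      proof
        fix N assume N: "N \<in> hidden b'"
        then have "N \<noteq> M" using vis by (auto simp: hidden_def)
        moreover from this have "visible_trace W L b' N \<longleftrightarrow> visible_trace W L b N"
          by (intro visible_trace_cong) (auto simp: b'_def indices_with_trace_def)
        ultimately show "N \<in> hidden b - {M}" using N by (auto simp: hidden_def)
      qed
      moreover have "M \<in> hidden b" using hid by (auto simp: hidden_def M_def)
      moreover have "finite (hidden b)"
        unfolding hidden_def by (rule finite_subset[of _ ?traces]) auto
      ultimately have "card (hidden b') < card (hidden b)"
        by (intro psubset_card_mono) auto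
      then show False using le by simp
    qed
    then obtain j f where j: "j \<in> ?I" "b j = -1" "row j W \<bullet> f = 0"
      and f: "\<And>m. m \<in> ?I \<Longrightarrow> hyperplane W m \<noteq> hyperplane W j \<Longrightarrow> 0 < b m * (row m W \<bullet> f)"
      unfolding visible_trace_def by blast
    obtain s where s: "0 < s" "\<And>m. 0 < ?u m \<bullet> y \<Longrightarrow> 0 < ?u m \<bullet> y + s * (?u m \<bullet> f)"
      using pos_perturb[of "\<lambda>m. ?u m \<bullet> y" "\<lambda>m. ?u m \<bullet> f"] by blast
    have "is_wall ?u j"
      unfolding is_wall_def
    proof (intro exI[of _ "y + s *\<^sub>R f"] conjI allI impI)
      show "?u j \<bullet> (y + s *\<^sub>R f) = 0"
        using yI[OF j(1)] j(3) by (simp add: inner_add_right)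
      fix m assume m: "{x. ?u m \<bullet> x = 0} \<noteq> {x. ?u j \<bullet> x = 0}"
      have split: "?u m \<bullet> (y + s *\<^sub>R f) = ?u m \<bullet> y + s * (?u m \<bullet> f)"
        by (simp only: inner_add_right inner_scaleR_right)
      show "0 < ?u m \<bullet> (y + s *\<^sub>R f)"
      proof (cases "m \<in> ?I")
        case True
        have "hyperplane W m \<noteq> hyperplane W j"
          using m hyperplane_signed[of b W m, OF b] hyperplane_signed[of b W j, OF b] by simp
        then have "0 < ?u m \<bullet> f" using f[OF True] by simp
        moreover have "?u m \<bullet> y = 0" using yI[OF True] by simp
        ultimately show ?thesis unfolding split using s(1) by (simp del: signed_rows_inner)
      next
        case False
        then show ?thesis unfolding split by (intro s(2) y_pos)
      qed
    qed
    moreover have "region W b \<noteq> {}" using ne by blast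
    ultimately show ?thesis
      using j(2) I0(1)[OF j(1)] by (intro in_Lambda_if_wall[OF b W _ x(2,3)])
  qed
  then show thesis using that b ne by blast
qed

section \<open>The homotopy type of the visible part\<close>

lemma continuous_on_Min_image:
  fixes f :: "'i \<Rightarrow> 'a::topological_space \<Rightarrow> real"
  assumes "finite I" "I \<noteq> {}" "\<And>i. i \<in> I \<Longrightarrow> continuous_on S (f i)"
  shows "continuous_on S (\<lambda>x. Min ((\<lambda>i. f i x) ` I))"
  using assms
proof (induction I rule: finite_ne_induct)
  case (singleton i)
  then show ?case by simp
next
  case (insert i I)
  have "Min ((\<lambda>i. f i x) ` insert i I) = min (f i x) (Min ((\<lambda>i. f i x) ` I))" for x
    using insert.hyps by simp
  moreover have "continuous_on S (\<lambda>x. min (f i x) (Min ((\<lambda>i. f i x) ` I)))"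
    using insert by (intro continuous_on_min) auto
  ultimately show ?case by simp
qed

text \<open>
  The set consists of the unit vectors of the cone in \<open>L\<close> at which direction \<open>p\<close> points out of the
  cone. It is a retract of the nonzero part of the cone, which is convex as the cone is pointed: push \<open>x\<close>
  along \<open>p\<close> as far as the cone permits, and normalize. The push ends because some \<open>u i \<bullet> p\<close> is
  negative. It does not end at the origin because otherwise \<open>x\<close> would be a multiple of \<open>- p\<close>, which
  violates constraint \<open>k\<close>.
\<close>

lemma contractible_outgoing_boundary:
  fixes u :: "'n::finite \<Rightarrow> 'a::euclidean_space"
  assumes L: "subspace L" "p \<in> L" and pointed: "\<And>x. (\<And>i. u i \<bullet> x = 0) \<Longrightarrow> x = 0"
    and neg: "\<exists>i. u i \<bullet> p < 0" and pos: "0 < u k \<bullet> p"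
  shows "contractible {x \<in> L \<inter> closed_cone u. norm x = 1 \<and> (\<exists>i. u i \<bullet> p < 0 \<and> u i \<bullet> x = 0)}"
    (is "contractible ?X")
proof (rule retract_of_contractible)
  let ?K = "L \<inter> closed_cone u - {0}"
  show "contractible ?K"
  proof (rule convex_imp_contractible, rule convexI)
    fix x y and s t :: real
    assume x: "x \<in> ?K" and y: "y \<in> ?K" and st: "0 \<le> s" "0 \<le> t" "s + t = 1"
    have C: "s *\<^sub>R x + t *\<^sub>R y \<in> closed_cone u"
      using x y st by (auto simp: closed_cone_def inner_add_right)
    moreover have "s *\<^sub>R x + t *\<^sub>R y \<in> L"
      using x y L(1) by (auto intro!: subspace_add subspace_scale)
    moreover have "s *\<^sub>R x + t *\<^sub>R y \<noteq> 0"
    proof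
      assume eq: "s *\<^sub>R x + t *\<^sub>R y = 0"
      have ge: "0 \<le> u i \<bullet> x" "0 \<le> u i \<bullet> y" for i using x y by (auto simp: closed_cone_def)
      have sum: "s * (u i \<bullet> x) + t * (u i \<bullet> y) = 0" for i
        using arg_cong[OF eq, of "inner (u i)"] by (simp add: inner_add_right)
      have 0: "s * (u i \<bullet> x) = 0" "t * (u i \<bullet> y) = 0" for i
        using sum[of i] mult_nonneg_nonneg[OF st(1) ge(1), of i] mult_nonneg_nonneg[OF st(2) ge(2), of i]
        by linarith+
      consider "s \<noteq> 0" | "t \<noteq> 0" using st(3) by fastforce
      then show False
      proof cases
        case 1
        then have "x = 0" using 0(1) by (intro pointed) simp
        then show False using x by simp
      next
        case 2
        then have "y = 0" using 0(2) by (intro pointed) simp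
        then show False using y by simp
      qed
    qed
    ultimately show "s *\<^sub>R x + t *\<^sub>R y \<in> ?K" by simp
  qed
  define N where "N = {i. u i \<bullet> p < 0}"
  \<comment> \<open>The length of the push: the time at which the first constraint becomes active.\<close>
  define \<tau> where "\<tau> x = Min ((\<lambda>i. (u i \<bullet> x) / - (u i \<bullet> p)) ` N)" for x
  define r where "r x = x + \<tau> x *\<^sub>R p" for x
  have N: "finite N" "N \<noteq> {}" using neg by (auto simp: N_def)
  have \<tau>_le: "\<tau> x \<le> (u i \<bullet> x) / - (u i \<bullet> p)" if "i \<in> N" for x i
    unfolding \<tau>_def using N that by (intro Min_le) auto
  have \<tau>_eq: "\<exists>i\<in>N. \<tau> x = (u i \<bullet> x) / - (u i \<bullet> p)" for x
  proof -
    have "\<tau> x \<in> (\<lambda>i. (u i \<bullet> x) / - (u i \<bullet> p)) ` N"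
      unfolding \<tau>_def using N by (intro Min_in) auto
    then show ?thesis by blast
  qed
  have cone: "0 \<le> u i \<bullet> x" if "x \<in> ?K" for i x using that by (simp add: closed_cone_def)
  have \<tau>_ge: "0 \<le> \<tau> x" if x: "x \<in> ?K" for x
  proof -
    obtain i where "i \<in> N" "\<tau> x = (u i \<bullet> x) / - (u i \<bullet> p)" using \<tau>_eq by blast
    then show ?thesis using cone[OF x, of i] by (simp add: N_def divide_nonneg_neg)
  qed
  have ur: "u i \<bullet> r x = u i \<bullet> x + \<tau> x * (u i \<bullet> p)" for i x
    by (simp add: r_def inner_add_right)
  have r_cone: "0 \<le> u i \<bullet> r x" if x: "x \<in> ?K" for i x
  proof (cases "i \<in> N")
    case True
    then have "u i \<bullet> p < 0" by (simp add: N_def)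
    with \<tau>_le[OF True, of x] show ?thesis by (simp add: ur field_simps)
  next
    case False
    then have "0 \<le> \<tau> x * (u i \<bullet> p)" using \<tau>_ge[OF x] by (simp add: N_def)
    then show ?thesis using cone[OF x, of i] by (simp add: ur)
  qed
  have r_wall: "\<exists>i. u i \<bullet> p < 0 \<and> u i \<bullet> r x = 0" for x
  proof -
    obtain i where "i \<in> N" "\<tau> x = (u i \<bullet> x) / - (u i \<bullet> p)" using \<tau>_eq by blast
    then show ?thesis by (intro exI[of _ i]) (simp add: N_def ur)
  qed
  have r_nz: "r x \<noteq> 0" if x: "x \<in> ?K" for x
  proof
    assume rx: "r x = 0"
    then have "u k \<bullet> x + \<tau> x * (u k \<bullet> p) = 0" using ur[of k x] by simp
    moreover have "0 \<le> \<tau> x * (u k \<bullet> p)" using \<tau>_ge[OF x] pos by simp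
    ultimately have "\<tau> x * (u k \<bullet> p) = 0" using cone[OF x, of k] by linarith
    then have "\<tau> x = 0" using pos by simp
    then show False using rx x by (simp add: r_def)
  qed
  have r_L: "r x \<in> L" if "x \<in> ?K" for x
    unfolding r_def using that L by (intro subspace_add subspace_scale) auto
  have r_fix: "r x = x" if x: "x \<in> ?X" for x
  proof -
    obtain i where i: "i \<in> N" "u i \<bullet> x = 0" using x by (auto simp: N_def)
    have "x \<in> ?K" using x by auto
    then have "\<tau> x = 0" using \<tau>_ge[of x] \<tau>_le[OF i(1), of x] i(2) by simp
    then show ?thesis by (simp add: r_def)
  qed
  have "retraction ?K ?X (\<lambda>x. r x /\<^sub>R norm (r x))"
    unfolding retraction_def
  proof (intro conjI)
    show "?X \<subseteq> ?K" by auto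
    have "continuous_on ?K \<tau>"
      unfolding \<tau>_def using N by (intro continuous_on_Min_image continuous_intros) (auto simp: N_def)
    then have "continuous_on ?K r"
      unfolding r_def by (intro continuous_intros)
    then show "continuous_on ?K (\<lambda>x. r x /\<^sub>R norm (r x))"
      using r_nz by (intro continuous_intros) auto
    show "(\<lambda>x. r x /\<^sub>R norm (r x)) \<in> ?K \<rightarrow> ?X"
    proof
      fix x assume x: "x \<in> ?K"
      obtain i where i: "u i \<bullet> p < 0" "u i \<bullet> r x = 0" using r_wall by blast
      have "r x /\<^sub>R norm (r x) \<in> closed_cone u"
        by (rule closed_cone_scale) (auto simp: closed_cone_def r_cone[OF x])
      moreover have "r x /\<^sub>R norm (r x) \<in> L" using r_L[OF x] L(1) by (intro subspace_scale)
      moreover have "norm (r x /\<^sub>R norm (r x)) = 1" using r_nz[OF x] by simp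
      moreover have "u i \<bullet> (r x /\<^sub>R norm (r x)) = 0" using i(2) by simp
      ultimately show "r x /\<^sub>R norm (r x) \<in> ?X" using i(1) by blast
    qed
    show "\<forall>x\<in>?X. r x /\<^sub>R norm (r x) = x" using r_fix by simp
  qed
  then show "?X retract_of ?K" unfolding retract_of_def by blast
qed

lemma homeomorphic_imp_homeomorphic_space:
  assumes "S homeomorphic T"
  shows "top_of_set S homeomorphic_space top_of_set T"
proof -
  obtain f g where "\<forall>x\<in>S. f x \<in> T \<and> g (f x) = x" "\<forall>y\<in>T. g y \<in> S \<and> f (g y) = y"
    "continuous_on S f" "continuous_on T g"
    using assms unfolding homeomorphic_minimal by blast
  then have "homeomorphic_maps (top_of_set S) (top_of_set T) f g"
    by (auto simp: homeomorphic_maps_def continuous_map_in_subtopology)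
  then show ?thesis by (rule homeomorphic_maps_imp_homeomorphic_space)
qed

lemma rel_frontier_convex_Int_affine:
  fixes S :: "'a::euclidean_space set"
  assumes "convex S" "closed S" "affine T" "interior S \<inter> T \<noteq> {}"
  shows "rel_frontier (S \<inter> T) = (S - interior S) \<inter> T"
proof -
  have "closed T" using closed_affine_hull[of T] hull_same[of affine T] assms(3) by simp
  then have "closure (S \<inter> T) = S \<inter> T" using assms(2) by (intro closure_closed closed_Int)
  then show ?thesis
    using rel_interior_convex_Int_affine[OF assms(1,3,4)] by (auto simp: rel_frontier_def)
qed

text \<open>
  The sum \<open>v\<close> of the normals is positive on the nonzero part of the pointed cone, so the slice \<open>Q\<close> of the
  cone in \<open>L\<close> at \<open>v \<bullet> x = 1\<close> is a compact convex set of dimension \<open>dim L - 1\<close>. Radial projection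
  identifies the boundary on the unit sphere with the relative frontier of \<open>Q\<close>, and relative
  frontiers of bounded convex sets of equal dimension are homeomorphic.
\<close>

lemma boundary_homeomorphic_nsphere:
  fixes u :: "'n::finite \<Rightarrow> 'a::euclidean_space"
  assumes L: "subspace L" "2 \<le> dim L" and pointed: "\<And>x. (\<And>i. u i \<bullet> x = 0) \<Longrightarrow> x = 0"
    and z: "z \<in> L" "z \<in> open_cone u"
  shows "top_of_set {x \<in> L \<inter> closed_cone u. norm x = 1 \<and> (\<exists>i. u i \<bullet> x = 0)}
    homeomorphic_space nsphere (dim L - 2)"
    (is "top_of_set ?X homeomorphic_space _")
proof -
  define v where "v = (\<Sum>i\<in>UNIV. u i)"
  have vx: "v \<bullet> x = (\<Sum>i\<in>UNIV. u i \<bullet> x)" for x by (simp add: v_def inner_sum_left)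
  have v_pos: "0 < v \<bullet> x" if "x \<in> closed_cone u" "x \<noteq> 0" for x
  proof -
    have ge: "0 \<le> u i \<bullet> x" for i using that(1) by (simp add: closed_cone_def)
    have "\<exists>i. u i \<bullet> x \<noteq> 0" using pointed that(2) by blast
    then obtain i where "u i \<bullet> x \<noteq> 0" ..
    with ge[of i] have "0 < u i \<bullet> x" by simp
    then show ?thesis unfolding vx using ge by (intro sum_pos2[of UNIV i]) auto
  qed
  have u: "u i \<noteq> 0" for i
  proof -
    have "0 < u i \<bullet> z" using z(2) by (simp add: open_cone_def)
    then show ?thesis by auto
  qed
  note int = interior_closed_cone[of u, OF u]
  have zc: "z \<in> closed_cone u" using z(2) int interior_subset by blast
  have z0: "z \<noteq> 0"
  proof
    assume "z = 0"
    then have "x = 0" for x :: 'a using z(2) by (intro pointed) (simp add: open_cone_def)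
    then have "L \<subseteq> {0}" by blast
    then have "dim L = 0" by (simp add: dim_eq_0)
    then show False using L(2) by linarith
  qed
  have vz: "0 < v \<bullet> z" using v_pos zc z0 by blast
  define A where "A = L \<inter> {x. v \<bullet> x = 1}"
  define Q where "Q = closed_cone u \<inter> A"
  define z1 where "z1 = inverse (v \<bullet> z) *\<^sub>R z"
  have z1A: "z1 \<in> A"
    unfolding A_def z1_def using L(1) z(1) vz by (auto intro!: subspace_scale)
  have z1o: "z1 \<in> interior (closed_cone u)"
    unfolding int using z(2) vz by (simp add: open_cone_def z1_def)
  have affA: "affine A"
    unfolding A_def using L(1) by (intro affine_Int subspace_imp_affine affine_hyperplane)
  have aff_dimA: "aff_dim A = int (dim L) - 1"
  proof -
    have "0 \<in> L" using L(1) by (rule subspace_0)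
    then have "\<not> L \<subseteq> {x. v \<bullet> x = 1}" by auto
    then show ?thesis
      using aff_dim_affine_Int_hyperplane[OF subspace_imp_affine[OF L(1)], of v 1] z1A
      unfolding A_def by (auto simp: aff_dim_subspace[OF L(1)])
  qed
  have aff_dimQ: "aff_dim Q = int (dim L) - 1"
    using aff_dim_convex_Int_nonempty_interior[of A "closed_cone u"] affine_imp_convex[OF affA]
      z1A z1o aff_dimA by (auto simp: Q_def Int_commute)
  have convexQ: "convex Q"
    unfolding Q_def using affA by (intro convex_Int convex_closed_cone affine_imp_convex)
  have frontierQ: "rel_frontier Q = {x \<in> Q. \<exists>i. u i \<bullet> x = 0}"
  proof -
    have "rel_frontier Q = (closed_cone u - open_cone u) \<inter> A"
      unfolding Q_def int[symmetric]
      using affA z1A z1o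
      by (intro rel_frontier_convex_Int_affine convex_closed_cone closed_closed_cone) auto
    also have "\<dots> = {x \<in> Q. \<exists>i. u i \<bullet> x = 0}"
    proof -
      have "x \<notin> open_cone u \<longleftrightarrow> (\<exists>i. u i \<bullet> x = 0)" if "x \<in> closed_cone u" for x
      proof -
        have "0 \<le> u i \<bullet> x" for i using that by (simp add: closed_cone_def)
        then have "\<not> 0 < u i \<bullet> x \<longleftrightarrow> u i \<bullet> x = 0" for i by (metis less_le not_less)
        then show ?thesis by (simp add: open_cone_def)
      qed
      then show ?thesis unfolding Q_def by blast
    qed
    finally show ?thesis .
  qed
  have boundedQ: "bounded Q"
  proof -
    let ?S = "closed_cone u \<inter> sphere 0 1"
    have "compact ?S" using closed_closed_cone by (rule closed_Int_compact) simp
    moreover have "inverse (norm z) *\<^sub>R z \<in> ?S"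
      using closed_cone_scale[OF zc, of "inverse (norm z)"] z0 by simp
    moreover have "continuous_on ?S (\<lambda>x. v \<bullet> x)" by (intro continuous_intros)
    ultimately obtain y where y: "y \<in> ?S" "\<And>x. x \<in> ?S \<Longrightarrow> v \<bullet> y \<le> v \<bullet> x"
      using continuous_attains_inf[of ?S "\<lambda>x. v \<bullet> x"] by blast
    have "0 < v \<bullet> y" using y(1) by (intro v_pos) auto
    have "norm x \<le> inverse (v \<bullet> y)" if x: "x \<in> Q" for x
    proof (cases "x = 0")
      case False
      have "inverse (norm x) *\<^sub>R x \<in> ?S"
        using closed_cone_scale[of x u "inverse (norm x)"] x False by (simp add: Q_def)
      then have "v \<bullet> y \<le> inverse (norm x)"
        using y(2)[of "inverse (norm x) *\<^sub>R x"] x by (simp add: Q_def A_def)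
      then show ?thesis using \<open>0 < v \<bullet> y\<close> False by (simp add: field_simps)
    qed (use \<open>0 < v \<bullet> y\<close> in simp)
    then show ?thesis by (auto simp: bounded_iff)
  qed
  have "?X homeomorphic rel_frontier Q"
    unfolding homeomorphic_minimal
  proof (rule exI[of _ "\<lambda>x. inverse (v \<bullet> x) *\<^sub>R x"], rule exI[of _ "\<lambda>x. inverse (norm x) *\<^sub>R x"],
      intro conjI ballI)
    fix x assume x: "x \<in> ?X"
    then have vx: "0 < v \<bullet> x" by (intro v_pos) auto
    have "inverse (v \<bullet> x) *\<^sub>R x \<in> closed_cone u"
      using x vx by (intro closed_cone_scale) auto
    moreover have "inverse (v \<bullet> x) *\<^sub>R x \<in> L"
      using x L(1) by (intro subspace_scale) auto
    ultimately show "inverse (v \<bullet> x) *\<^sub>R x \<in> rel_frontier Q"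
      unfolding frontierQ using x vx by (auto simp: Q_def A_def)
    show "inverse (norm (inverse (v \<bullet> x) *\<^sub>R x)) *\<^sub>R inverse (v \<bullet> x) *\<^sub>R x = x"
      using x vx by simp
  next
    fix y assume y: "y \<in> rel_frontier Q"
    then have yQ: "y \<in> closed_cone u" "y \<in> L" "v \<bullet> y = 1" "\<exists>i. u i \<bullet> y = 0"
      unfolding frontierQ by (auto simp: Q_def A_def)
    then have "y \<noteq> 0" by auto
    have "inverse (norm y) *\<^sub>R y \<in> closed_cone u"
      using yQ(1) by (intro closed_cone_scale) auto
    moreover have "inverse (norm y) *\<^sub>R y \<in> L"
      using yQ(2) L(1) by (intro subspace_scale)
    ultimately show "inverse (norm y) *\<^sub>R y \<in> ?X"
      using yQ(4) \<open>y \<noteq> 0\<close> by auto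
    show "inverse (v \<bullet> inverse (norm y) *\<^sub>R y) *\<^sub>R inverse (norm y) *\<^sub>R y = y"
      using yQ(3) \<open>y \<noteq> 0\<close> by simp
  next
    have "v \<bullet> x \<noteq> 0" if "x \<in> ?X" for x
    proof -
      have "0 < v \<bullet> x" using that by (intro v_pos) auto
      then show ?thesis by simp
    qed
    then show "continuous_on ?X (\<lambda>x. inverse (v \<bullet> x) *\<^sub>R x)"
      by (intro continuous_intros) blast
    have "norm y \<noteq> 0" if "y \<in> rel_frontier Q" for y
      using that unfolding frontierQ by (auto simp: Q_def A_def)
    then show "continuous_on (rel_frontier Q) (\<lambda>x. inverse (norm x) *\<^sub>R x)"
      by (intro continuous_intros) blast
  qed
  also have "rel_frontier Q homeomorphic sphere 0 1 \<inter> (L \<inter> {x. v \<bullet> x = 0})"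
  proof -
    let ?T = "L \<inter> {x. v \<bullet> x = 0}"
    have T: "subspace ?T" using L(1) by (intro subspace_inter subspace_hyperplane)
    have 0: "0 \<in> interior (cball 0 1 :: 'a set) \<inter> ?T" using subspace_0[OF T] by simp
    have "rel_frontier (cball 0 1 \<inter> ?T) = (cball 0 1 - interior (cball 0 1)) \<inter> ?T"
    proof (rule rel_frontier_convex_Int_affine[OF convex_cball closed_cball subspace_imp_affine[OF T]])
      show "interior (cball 0 1) \<inter> ?T \<noteq> {}" using 0 by blast
    qed
    also have "\<dots> = sphere 0 1 \<inter> ?T" by (auto simp: less_le)
    finally have eq: "rel_frontier (cball 0 1 \<inter> ?T) = sphere 0 1 \<inter> ?T" .
    have "aff_dim ?T = int (dim L) - 1"
      using aff_dim_affine_Int_hyperplane[OF subspace_imp_affine[OF L(1)], of v 0] vz z(1) subspace_0[OF T]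
      by (auto simp: aff_dim_subspace[OF L(1)])
    moreover have "aff_dim (cball 0 1 \<inter> ?T) = aff_dim ?T"
      unfolding Int_commute[of "cball 0 1"] using 0
      by (intro aff_dim_convex_Int_nonempty_interior subspace_imp_convex[OF T]) blast
    ultimately have "aff_dim (cball 0 1 \<inter> ?T) = aff_dim Q" using aff_dimQ by simp
    then have "rel_frontier Q homeomorphic rel_frontier (cball 0 1 \<inter> ?T)"
      by (intro homeomorphic_rel_frontiers_convex_bounded_sets convexQ boundedQ
          convex_Int[OF convex_cball subspace_imp_convex[OF T]]) (auto simp: bounded_Int)
    then show ?thesis unfolding eq .
  qed
  finally have 1: "top_of_set ?X homeomorphic_space top_of_set (sphere 0 1 \<inter> (L \<inter> {x. v \<bullet> x = 0}))"
    by (rule homeomorphic_imp_homeomorphic_space)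
  let ?T = "L \<inter> {x. v \<bullet> x = 0}"
  have T: "subspace ?T" using L(1) by (intro subspace_inter subspace_hyperplane)
  have "int (dim ?T) = int (dim L) - 1"
    using aff_dim_affine_Int_hyperplane[OF subspace_imp_affine[OF L(1)], of v 0] vz z(1) subspace_0[OF T]
    by (auto simp: aff_dim_subspace[OF L(1)] aff_dim_subspace[OF T])
  then have dimT: "dim ?T = dim L - 1" by simp
  obtain B where B: "pairwise orthogonal B" "\<And>x. x \<in> B \<Longrightarrow> norm x = 1" "independent B"
      "card B = dim L - 1" "span B = ?T"
    using orthonormal_basis_subspace[OF T] dimT by metis
  obtain f :: "(nat \<Rightarrow> real) \<Rightarrow> 'a" and g
    where "homeomorphic_maps (nsphere (dim L - 1 - 1)) (top_of_set (sphere 0 1 \<inter> span B)) f g"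
    using homeomorphic_maps_nsphere_euclidean_sphere[OF B(3,1,4)] B(2) L(2) by force
  then have "nsphere (dim L - 2) homeomorphic_space top_of_set (sphere 0 1 \<inter> ?T)"
    unfolding B(5) using homeomorphic_maps_imp_homeomorphic_space by (simp add: numeral_2_eq_2)
  then show ?thesis
    using 1 homeomorphic_space_trans homeomorphic_space_sym by blast
qed


section \<open>The alternative\<close>

lemma pointed_if_rows_span:
  fixes W :: "real^'k^'n"
  assumes "span (rows W) = UNIV" "\<And>i. row i W \<bullet> x = 0"
  shows "x = 0"
proof -
  have "rows W \<subseteq> {y. x \<bullet> y = 0}" using assms(2) by (auto simp: rows_def inner_commute)
  then have "span (rows W) \<subseteq> {y. x \<bullet> y = 0}" by (intro span_minimal subspace_hyperplane)
  then have "x \<bullet> x = 0" using assms(1) by blast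
  then show ?thesis by simp
qed

theorem corollary3p55:
  fixes W :: "real^'k^'n" and L :: "(real^'k) set" and l :: nat
  assumes "\<forall>i. row i W \<noteq> 0"
    and "span (rows W) = UNIV"
    and "subspace L"
    and "dim L = l"
    and "l \<ge> 2"
    and "\<forall>i. \<not> L \<subseteq> hyperplane W i"
  shows "let
      alt1 = (L \<inter> region W (\<lambda>_. 1) \<noteq> {});
      alt2 = (\<exists>b. (\<forall>i. b i \<in> {-1, 1}) \<and> b \<noteq> (\<lambda>_. 1) \<and> b \<noteq> (\<lambda>_. -1) \<and>
         L \<inter> Lambda W b \<noteq> {} \<and>
         (\<exists>i::nat. \<not> trivial_group
            (reduced_cohomology_group (int l - 2 - int i) (top_of_set (L \<inter> Lambda W b))
              :: ((real^'k) sing_simplex \<Rightarrow> 'f::field) set monoid)))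
    in (alt1 \<or> alt2) \<and> \<not> (alt1 \<and> alt2)"
proof -
  have W: "row i W \<noteq> 0" for i using assms(1) by blast
  have LH: "\<not> L \<subseteq> hyperplane W i" for i using assms(6) by blast
  let ?H = "\<lambda>d b. reduced_cohomology_group d (top_of_set (L \<inter> Lambda W b))
      :: ((real^'k) sing_simplex \<Rightarrow> 'f) set monoid"
  have pointed: "x = 0" if b: "\<And>i. b i \<in> {-1, 1}" and x: "\<And>i. signed_rows W b i \<bullet> x = 0" for b x
  proof (rule pointed_if_rows_span[OF assms(2)])
    show "row i W \<bullet> x = 0" for i using x[of i] b[of i] by auto
  qed
  have Lambda_sub: "x \<in> closed_cone (signed_rows W b) \<and> norm x = 1 \<and> (\<exists>i. b i = -1 \<and> row i W \<bullet> x = 0)"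
    if b: "\<And>i. b i \<in> {-1, 1}" and x: "x \<in> Lambda W b" for b x
    using in_LambdaD[of b x W, OF b x] closure_region[of b W, OF b W] by simp
  have acyclic: "trivial_group (?H d b)"
    if p: "p \<in> L" "p \<in> region W (\<lambda>_. 1)" and b: "\<And>i. b i \<in> {-1, 1}"
      and ne1: "b \<noteq> (\<lambda>_. 1)" "b \<noteq> (\<lambda>_. -1)" and nonempty: "L \<inter> Lambda W b \<noteq> {}" for p b d
  proof -
    let ?u = "signed_rows W b"
    have pt: "x = 0" if "\<And>i. ?u i \<bullet> x = 0" for x
      using b that by (rule pointed)
    have wp: "0 < row i W \<bullet> p" for i
    proof -
      have "sgn (row i W \<bullet> p) = 1" using p(2) unfolding region_iff by blast
      then show ?thesis by (simp add: sgn_1_pos)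
    qed
    have up: "?u i \<bullet> p < 0 \<longleftrightarrow> b i = -1" "0 < ?u i \<bullet> p \<longleftrightarrow> b i = 1" for i
      using wp[of i] b[of i] by auto
    obtain j where "b j \<noteq> 1" using ne1(1) by blast
    then have "b j = -1" using b[of j] by simp
    then have neg: "\<exists>i. ?u i \<bullet> p < 0" using up(1) by blast
    obtain k where "b k \<noteq> -1" using ne1(2) by blast
    then have "b k = 1" using b[of k] by simp
    then have pos: "0 < ?u k \<bullet> p" using up(2) by blast
    have "L \<inter> Lambda W b =
        {x \<in> L \<inter> closed_cone ?u. norm x = 1 \<and> (\<exists>i. ?u i \<bullet> p < 0 \<and> ?u i \<bullet> x = 0)}" (is "_ = ?X")
    proof
      show "L \<inter> Lambda W b \<subseteq> ?X"
        using Lambda_sub[of b, OF b] unfolding up(1) by fastforce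
      show "?X \<subseteq> L \<inter> Lambda W b"
      proof
        fix x assume x: "x \<in> ?X"
        then obtain i where i: "b i = -1" "?u i \<bullet> x = 0" unfolding up(1) by blast
        have "region W b \<noteq> {}" using nonempty in_LambdaD(1)[of b _ W, OF b] by blast
        then have "x \<in> Lambda W b"
          using x i active_in_Lambda[of b W p x i, OF b W _ p(2)] by auto
        then show "x \<in> L \<inter> Lambda W b" using x by blast
      qed
    qed
    then have "contractible (L \<inter> Lambda W b)"
      using contractible_outgoing_boundary[of L p ?u k, OF assms(3) p(1) pt neg pos] by (simp del: signed_rows_inner)
    then show ?thesis
      using nonempty by (intro trivial_reduced_cohomology_group_contractible) auto
  qed
  have visible: "\<exists>b. (\<forall>i. b i \<in> {-1, 1}) \<and> b \<noteq> (\<lambda>_. 1) \<and> b \<noteq> (\<lambda>_. -1) \<and>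
      L \<inter> Lambda W b \<noteq> {} \<and> \<not> trivial_group (?H (int l - 2) b)"
    if empty: "L \<inter> region W (\<lambda>_. 1) = {}"
  proof -
    obtain b where b: "\<And>i. b i \<in> {-1, 1}" and ne: "L \<inter> region W b \<noteq> {}" and
      bd: "\<And>x k. x \<in> L \<Longrightarrow> x \<in> closed_cone (signed_rows W b) \<Longrightarrow> norm x = 1 \<Longrightarrow>
        row k W \<bullet> x = 0 \<Longrightarrow> x \<in> Lambda W b"
      using exists_region_with_visible_boundary[of W L, OF W assms(3) LH] by blast
    let ?u = "signed_rows W b"
    have pt: "x = 0" if "\<And>i. ?u i \<bullet> x = 0" for x
      using b that by (rule pointed)
    obtain z where z: "z \<in> L" "z \<in> region W b" using ne by blast
    have zo: "z \<in> open_cone ?u" using z(2) region_eq_open_cone[of b W, OF b] by simp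
    have "b \<noteq> (\<lambda>_. 1)" using ne empty by blast
    moreover have "b \<noteq> (\<lambda>_. -1)"
    proof
      assume "b = (\<lambda>_. -1)"
      then have "sgn (row i W \<bullet> z) = -1" for i using z(2) unfolding region_iff by blast
      then have "- z \<in> region W (\<lambda>_. 1)" by (simp add: region_iff sgn_minus)
      then show False using empty subspace_neg[OF assms(3) z(1)] by blast
    qed
    moreover have eq: "L \<inter> Lambda W b = {x \<in> L \<inter> closed_cone ?u. norm x = 1 \<and> (\<exists>i. ?u i \<bullet> x = 0)}"
      (is "_ = ?X")
    proof
      show "L \<inter> Lambda W b \<subseteq> ?X"
        using Lambda_sub[of b, OF b] by fastforce
      show "?X \<subseteq> L \<inter> Lambda W b"
      proof
        fix x assume x: "x \<in> ?X"
        then obtain i where "?u i \<bullet> x = 0" by blast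
        then have "row i W \<bullet> x = 0" using b[of i] by auto
        then show "x \<in> L \<inter> Lambda W b" using x bd[of x i] by blast
      qed
    qed
    have hs: "top_of_set (L \<inter> Lambda W b) homeomorphic_space nsphere (l - 2)"
      using boundary_homeomorphic_nsphere[of L ?u z, OF assms(3) _ pt z(1) zo] assms(4,5)
      unfolding eq by simp
    moreover have "L \<inter> Lambda W b \<noteq> {}"
    proof
      assume "L \<inter> Lambda W b = {}"
      then have "(\<lambda>x. x) ` topspace (nsphere (l - 2)) = {}"
        using homeomorphic_empty_space[OF hs] by simp
      then show False using in_topspace_nsphere by blast
    qed
    moreover have "\<not> trivial_group (?H (int (l - 2)) b)"
      using hs by (rule nontrivial_reduced_cohomology_group_nsphere)
    ultimately show ?thesis using b assms(5) by (auto simp: of_nat_diff)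
  qed
  have alternative: "L \<inter> region W (\<lambda>_. 1) \<noteq> {} \<or>
      (\<exists>b. (\<forall>i. b i \<in> {-1, 1}) \<and> b \<noteq> (\<lambda>_. 1) \<and> b \<noteq> (\<lambda>_. -1) \<and>
         L \<inter> Lambda W b \<noteq> {} \<and> (\<exists>i::nat. \<not> trivial_group (?H (int l - 2 - int i) b)))"
  proof (cases "L \<inter> region W (\<lambda>_. 1) = {}")
    case True
    from visible[OF this] obtain b where "\<forall>i. b i \<in> {-1, 1}" "b \<noteq> (\<lambda>_. 1)" "b \<noteq> (\<lambda>_. -1)"
      "L \<inter> Lambda W b \<noteq> {}" "\<not> trivial_group (?H (int l - 2 - int 0) b)" by auto
    then show ?thesis by blast
  qed blast
  have exclusive: False
    if "L \<inter> region W (\<lambda>_. 1) \<noteq> {}" and "\<forall>i. b i \<in> {-1, 1}" "b \<noteq> (\<lambda>_. 1)" "b \<noteq> (\<lambda>_. -1)"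
      "L \<inter> Lambda W b \<noteq> {}" "\<not> trivial_group (?H d b)" for b d
    using that acyclic[of _ b d] by blast
  show ?thesis
    unfolding Let_def using alternative exclusive by blast
qed

end
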